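(* Let $(S,\mathcal{B})$ be a measurable space, let $X_n$ be the $n$th canonical projection on $(S^\infty,\mathcal{B}^\infty)$, and let $P$ be a probability on $(S^\infty,\mathcal{B}^\infty)$ under which the sequence $X=(X_1,X_2,\ldots)$ is conditionally identically distributed (c.i.d.). Let $\mathcal{D}\subset\mathcal{B}$ be countably determined, let $\|\cdot\|$ denote the sup-norm over $\mathcal{D}$, let $N$ be a random probability measure on $\mathbb{R}$ defined on the measurable space $(S^\infty,\mathcal{B}^\infty)$, and let $Q$ be a probability on $(S^\infty,\mathcal{B}^\infty)$. Suppose that $\|C_n^Q\|\to N$ stably under $Q$, and that $(\|W_n\|:n\ge 1)$ is uniformly integrable under $P$ and under $Q$. If $P\ll Q$, then $$\|C_n\|=\sqrt{n}\,\|\mu_n-a_n\|=\sqrt{n}\,\sup_{B\in\mathcal{D}}|\mu_n(B)-a_n(B)|\ \to\ N\quad\text{stably (under } P).$$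
   Context: $E$ denotes expectation under $P$ and $E_Q$ expectation under $Q$. $\mathcal{G}_0$ is the trivial $\sigma$-field and $\mathcal{G}_n=\sigma(X_1,\ldots,X_n)$. $X$ is c.i.d. under $P$ if $E(I_B(X_k)\mid\mathcal{G}_n)=E(I_B(X_{n+1})\mid\mathcal{G}_n)$ $P$-a.s. for all $B\in\mathcal{B}$ and $k>n\ge 0$. For $B\in\mathcal{B}$: $\mu_n(B)=\frac1n\sum_{i=1}^n I_B(X_i)$ (empirical measure); $a_n(B)=P(X_{n+1}\in B\mid\mathcal{G}_n)$ (predictive distribution under $P$); $\mu(B)=\limsup_n\mu_n(B)$; $W_n(B)=\sqrt{n}\{\mu_n(B)-\mu(B)\}$; $C_n^Q(B)=E_Q(W_n(B)\mid\mathcal{G}_n)$; $C_n(B)=C_n^P(B)=E(W_n(B)\mid\mathcal{G}_n)=\sqrt{n}\{\mu_n(B)-a_n(B)\}$ $P$-a.s. For a real function $F$ on $\mathcal{D}$, $\|F\|=\sup_{B\in\mathcal{D}}|F(B)|$. $\mathcal{D}\subset\mathcal{B}$ is countably determined if there is a countable subclass $\mathcal{D}_0\subset\mathcal{D}$ such that $\sup_{B\in\mathcal{D}_0}|\nu_1(B)-\nu_2(B)|=\sup_{B\in\mathcal{D}}|\nu_1(B)-\nu_2(B)|$ for every pair $\nu_1,\nu_2$ of probabilities on $\mathcal{B}$. This condition serves to handle measurability: suprema over $\mathcal{D}$ are understood as suprema over such a fixed $\mathcal{D}_0$, so that $\|W_n\|$, $\|C_n\|$, $\|C_n^Q\|$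 are random variables (well defined up to null sets). A random probability measure on $\mathbb{R}$ defined on a measurable space $(\Omega,\mathcal{A})$ is a map $N$ on $\Omega\times\mathcal{B}_{\mathbb{R}}$ ($\mathcal{B}_{\mathbb{R}}$ the Borel $\sigma$-field) such that $N(\omega,\cdot)$ is a probability on $\mathcal{B}_{\mathbb{R}}$ for each $\omega$ and $N(\cdot,A)$ is $\mathcal{A}$-measurable for each $A\in\mathcal{B}_{\mathbb{R}}$. Given a probability $R$ on $(\Omega,\mathcal{A})$, real random variables $Z_n$ converge to $N$ stably under $R$ if $R(Z_n\in\cdot\mid H)\to E_R(N(\cdot)\mid H)$ weakly for every $H\in\mathcal{A}$ with $R(H)>0$. *)

theory Defs
  imports "HOL-Probability.Probability"
begin

(* A measurable space is given by a measure S of which only space S and sets S matter.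
   Sequences are indexed by 1, 2, ..., so the n-th canonical projection is \<lambda>\<omega>. \<omega> n. *)

definition seq_space :: "'a measure \<Rightarrow> (nat \<Rightarrow> 'a) measure" where
  "seq_space S = Pi\<^sub>M {1..} (\<lambda>_. S)"

definition hist :: "'a measure \<Rightarrow> nat \<Rightarrow> (nat \<Rightarrow> 'a) measure" where
  "hist S n = sigma (space (seq_space S))
     {(\<lambda>\<omega>. \<omega> i) -` B \<inter> space (seq_space S) |i B. i \<in> {1..n} \<and> B \<in> sets S}"

definition cid :: "'a measure \<Rightarrow> (nat \<Rightarrow> 'a) measure \<Rightarrow> bool" where
  "cid S P \<longleftrightarrow>
     (\<forall>B\<in>sets S. \<forall>n k. n < k \<longrightarrow>
        (AE \<omega> in P. real_cond_exp P (hist S n) (\<lambda>\<omega>. indicator B (\<omega> k)) \<omega> =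
                    real_cond_exp P (hist S n) (\<lambda>\<omega>. indicator B (\<omega> (n + 1))) \<omega>))"

definition emp :: "nat \<Rightarrow> 'a set \<Rightarrow> (nat \<Rightarrow> 'a) \<Rightarrow> real" where
  "emp n B \<omega> = (\<Sum>i=1..n. indicator B (\<omega> i)) / real n"

definition pred :: "'a measure \<Rightarrow> (nat \<Rightarrow> 'a) measure \<Rightarrow> nat \<Rightarrow> 'a set \<Rightarrow> (nat \<Rightarrow> 'a) \<Rightarrow> real" where
  "pred S P n B = real_cond_exp P (hist S n) (\<lambda>\<omega>. indicator B (\<omega> (n + 1)))"

(* The limsup lies in the interval [0, 1], so real_of_ereal loses nothing. *)
definition emp_lim :: "'a set \<Rightarrow> (nat \<Rightarrow> 'a) \<Rightarrow> real" where
  "emp_lim B \<omega> = real_of_ereal (limsup (\<lambda>n. ereal (emp n B \<omega>)))"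

definition W :: "nat \<Rightarrow> 'a set \<Rightarrow> (nat \<Rightarrow> 'a) \<Rightarrow> real" where
  "W n B \<omega> = sqrt (real n) * (emp n B \<omega> - emp_lim B \<omega>)"

definition C :: "'a measure \<Rightarrow> (nat \<Rightarrow> 'a) measure \<Rightarrow> nat \<Rightarrow> 'a set \<Rightarrow> (nat \<Rightarrow> 'a) \<Rightarrow> real" where
  "C S R n B = real_cond_exp R (hist S n) (W n B)"

(* The supremum is taken in [0, \<infinity>], hence is 0 over the empty class; enn2real sends \<infinity> to 0.
   For the families used here the supremum is finite almost surely: W n B is bounded by
   sqrt n, so a version of its conditional expectation exceeds that bound only on a null
   set, and the class of sets is countable. *)
definition sup_norm :: "'b set \<Rightarrow> ('b \<Rightarrow> real) \<Rightarrow> real" where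
  "sup_norm D F = enn2real (SUP B\<in>D. ennreal \<bar>F B\<bar>)"

(* D is countably determined iff such a D0 exists. *)
definition countably_determines :: "'a measure \<Rightarrow> 'a set set \<Rightarrow> 'a set set \<Rightarrow> bool" where
  "countably_determines S D0 D \<longleftrightarrow>
     countable D0 \<and> D0 \<subseteq> D \<and>
     (\<forall>\<nu>1 \<nu>2. prob_space \<nu>1 \<and> sets \<nu>1 = sets S \<and> prob_space \<nu>2 \<and> sets \<nu>2 = sets S \<longrightarrow>
        sup_norm D0 (\<lambda>B. measure \<nu>1 B - measure \<nu>2 B) =
        sup_norm D (\<lambda>B. measure \<nu>1 B - measure \<nu>2 B))"

definition uniformly_integrable :: "'b measure \<Rightarrow> (nat \<Rightarrow> 'b \<Rightarrow> real) \<Rightarrow> bool" where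
  "uniformly_integrable R Z \<longleftrightarrow>
     (\<forall>n\<ge>1. Z n \<in> borel_measurable R) \<and>
     ((\<lambda>c. SUP n\<in>{1..}. \<integral>\<^sup>+\<omega>\<in>{\<omega>\<in>space R. c < \<bar>Z n \<omega>\<bar>}. ennreal \<bar>Z n \<omega>\<bar> \<partial>R) \<longlongrightarrow> 0) at_top"

(* uniform_measure R H is R conditioned on the event H, and the Giry bind
   uniform_measure R H \<bind> N is the law that maps A to E_R (N A | H). *)
definition stably_converges ::
  "'b measure \<Rightarrow> (nat \<Rightarrow> 'b \<Rightarrow> real) \<Rightarrow> ('b \<Rightarrow> real measure) \<Rightarrow> bool" where
  "stably_converges R Z N \<longleftrightarrow>
     (\<forall>n\<ge>1. Z n \<in> borel_measurable R) \<and>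
     (\<forall>H\<in>sets R. 0 < measure R H \<longrightarrow>
        weak_conv_m (\<lambda>n. distr (uniform_measure R H) borel (Z n)) (uniform_measure R H \<bind> N))"

end

theory Submission
  imports Defs
begin

text \<open>
  Let \<open>f = dP/dQ\<close> and \<open>f\<^sub>n = E\<^sub>Q(f | G\<^sub>n)\<close>. Two comparisons carry the proof.

  Replacing \<open>C\<^sup>Q\<close> by \<open>C\<^sup>P\<close> costs nothing in the limit. Bayes' formula (\<open>Bayes_cond_exp\<close>) turns a
  conditional expectation under \<open>P\<close> into one under \<open>Q\<close>, and it gives
  \<open>f\<^sub>n (C\<^sup>P\<^sub>n(B) - C\<^sup>Q\<^sub>n(B)) = E\<^sub>Q((f - f\<^sub>n) W\<^sub>n(B) | G\<^sub>n)\<close>, so that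
  \<open>f\<^sub>n \<parallel>C\<^sup>P\<^sub>n - C\<^sup>Q\<^sub>n\<parallel> \<le> E\<^sub>Q(\<bar>f - f\<^sub>n\<bar> \<parallel>W\<^sub>n\<parallel> | G\<^sub>n)\<close>. On the event \<open>f\<^sub>n \<le> K\<close> the right-hand side has
  small \<open>Q\<close>-expectation: where \<open>\<parallel>W\<^sub>n\<parallel> \<le> c\<close>, because \<open>f\<^sub>n \<rightarrow> f\<close> in \<open>L\<^sup>1(Q)\<close> by Levy's upward theorem
  (\<open>Levy_upward_L1\<close>), and where \<open>\<parallel>W\<^sub>n\<parallel> > c\<close>, because \<open>\<bar>f - f\<^sub>n\<bar> \<le> f + K\<close> there and \<open>\<parallel>W\<^sub>n\<parallel>\<close> is uniformly
  integrable under both \<open>P = f Q\<close> and \<open>Q\<close>. Since \<open>f\<^sub>n\<close> is tight under \<open>P\<close>, the difference of the two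
  norms tends to 0 in \<open>P\<close>-probability (\<open>sup_cond_exp_difference_tendsto_0\<close>).

  Stable convergence says exactly that \<open>E\<^sub>Q(\<phi> g(Z\<^sub>n)) \<rightarrow> E\<^sub>Q(\<phi> \<integral>g dN)\<close> for indicators \<open>\<phi>\<close> and bounded
  continuous \<open>g\<close>; by \<open>L\<^sup>1\<close>-approximation it holds for every \<open>Q\<close>-integrable \<open>\<phi>\<close>. Taking
  \<open>\<phi> = f 1\<^sub>H\<close> moves stable convergence from \<open>Q\<close> to \<open>P\<close>, and it survives a perturbation that vanishes
  in \<open>P\<close>-probability (\<open>stably_converges_change_of_measure\<close>).

  The identity \<open>C\<^sub>n = \<surd>n (\<mu>\<^sub>n - a\<^sub>n)\<close> is where the c.i.d. property enters. It makes \<open>a\<^sub>n(B)\<close> a bounded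
  martingale, hence almost surely convergent, and the averages of the innovations
  \<open>I\<^sub>B(X\<^sub>i) - a\<^sub>i\<^sub>-\<^sub>1(B)\<close> vanish by Kronecker's lemma. So \<open>\<mu>\<^sub>n(B)\<close> and \<open>a\<^sub>n(B)\<close> have the same limit
  \<open>\<mu>(B)\<close>, and the martingale is closed by it: \<open>E(\<mu>(B) | G\<^sub>n) = a\<^sub>n(B)\<close> (\<open>cond_exp_emp_lim\<close>).
\<close>

section \<open>Conditional expectations along a filtration and L1 convergence\<close>
text \<open>
  The approximating sequences produced by induction over integrable functions converge in \<open>L\<^sup>1\<close>:
  the hypotheses are those of the limit step of that induction.
\<close>
lemma dominated_L1_convergence:
  fixes f :: "'b \<Rightarrow> real"
  assumes s: "\<And>i. integrable M (s i)" and f: "integrable M f"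
    and lim: "\<And>x. x \<in> space M \<Longrightarrow> (\<lambda>i. s i x) \<longlonglongrightarrow> f x"
    and bound: "\<And>i x. x \<in> space M \<Longrightarrow> norm (s i x) \<le> 2 * norm (f x)"
  shows "(\<lambda>i. \<integral>x. \<bar>f x - s i x\<bar> \<partial>M) \<longlonglongrightarrow> 0"
proof -
  have "(\<lambda>i. \<integral>x. \<bar>f x - s i x\<bar> \<partial>M) \<longlonglongrightarrow> (\<integral>x. 0 \<partial>M)"
  proof (rule integral_dominated_convergence[where w="\<lambda>x. 3 * \<bar>f x\<bar>"])
    show "AE x in M. (\<lambda>i. \<bar>f x - s i x\<bar>) \<longlonglongrightarrow> 0"
      using tendsto_rabs_zero[OF LIM_zero, OF lim] by (auto simp: abs_minus_commute)
    show "AE x in M. norm \<bar>f x - s i x\<bar> \<le> 3 * \<bar>f x\<bar>" for i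
    proof (rule AE_I2)
      fix x assume "x \<in> space M"
      then show "norm \<bar>f x - s i x\<bar> \<le> 3 * \<bar>f x\<bar>" using bound[of x i] by simp
    qed
  qed (use s f in auto)
  then show ?thesis by simp
qed

lemma (in sigma_finite_subalgebra) real_cond_exp_abs_le:
  assumes f: "integrable M f" and g: "integrable M g" and le: "AE x in M. \<bar>f x\<bar> \<le> g x"
  shows "AE x in M. \<bar>real_cond_exp M F f x\<bar> \<le> real_cond_exp M F g x"
proof -
  have "AE x in M. real_cond_exp M F f x \<le> real_cond_exp M F g x"
    using le by (intro real_cond_exp_mono f g) auto
  moreover have "AE x in M. real_cond_exp M F (\<lambda>x. (-1) * f x) x \<le> real_cond_exp M F g x"
    using le by (intro real_cond_exp_mono integrable_mult_right f g) auto
  moreover have "AE x in M. real_cond_exp M F (\<lambda>x. (-1) * f x) x = (-1) * real_cond_exp M F f x"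
    by (intro real_cond_exp_cmult f)
  ultimately show ?thesis by eventually_elim auto
qed

lemma (in sigma_finite_subalgebra) real_cond_exp_contraction:
  assumes f: "integrable M f"
  shows "(\<integral>x. \<bar>real_cond_exp M F f x\<bar> \<partial>M) \<le> (\<integral>x. \<bar>f x\<bar> \<partial>M)"
proof -
  have "(\<integral>x. \<bar>real_cond_exp M F f x\<bar> \<partial>M) \<le> (\<integral>x. real_cond_exp M F (\<lambda>x. \<bar>f x\<bar>) x \<partial>M)"
    using f by (intro integral_mono_AE real_cond_exp_abs_le integrable_abs real_cond_exp_int(1)) auto
  also have "\<dots> = (\<integral>x. \<bar>f x\<bar> \<partial>M)"
    using f by (intro real_cond_exp_int(2) integrable_abs)
  finally show ?thesis .
qed

locale filtered_prob_space = prob_space M for M :: "'b measure" +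
  fixes F :: "nat \<Rightarrow> 'b measure"
  assumes subalgebra_F: "subalgebra M (F n)"
    and sets_F_mono: "m \<le> n \<Longrightarrow> sets (F m) \<subseteq> sets (F n)"
begin

lemma sigma_finite_subalgebra_F: "sigma_finite_subalgebra M (F n)"
  by (intro finite_measure_subalgebra_is_sigma_finite finite_measure_subalgebra.intro
      finite_measure_axioms finite_measure_subalgebra_axioms.intro subalgebra_F)

lemma space_F: "space (F n) = space M"
  using subalgebra_F by (auto simp: subalgebra_def)

lemma measurable_F: "f \<in> borel_measurable (F n) \<Longrightarrow> f \<in> borel_measurable M"
  by (rule measurable_from_subalg[OF subalgebra_F])

lemma measurable_F_mono:
  assumes "m \<le> n" "f \<in> borel_measurable (F m)"
  shows "f \<in> borel_measurable (F n)"
  using assms sets_F_mono[OF assms(1)] by (auto simp: measurable_def space_F)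

lemma sets_F_sub: "A \<in> sets (F n) \<Longrightarrow> A \<in> sets M"
  using subalgebra_F by (auto simp: subalgebra_def)

text \<open>
  The functions for which this error
  tends to 0 form a subspace that is closed in \<open>L\<^sup>1\<close>; Levy's upward theorem then only needs
  the indicators of a generator.
\<close>
definition cond_exp_error :: "('b \<Rightarrow> real) \<Rightarrow> nat \<Rightarrow> real" where
  "cond_exp_error f n = (\<integral>x. \<bar>f x - real_cond_exp M (F n) f x\<bar> \<partial>M)"

lemma cond_exp_error_nonneg: "0 \<le> cond_exp_error f n"
  by (simp add: cond_exp_error_def)

lemma integrable_cond_exp_F: "integrable M f \<Longrightarrow> integrable M (real_cond_exp M (F n) f)"
  using sigma_finite_subalgebra.real_cond_exp_int(1)[OF sigma_finite_subalgebra_F] by blast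

lemma cond_exp_error_add:
  assumes f: "integrable M f" and g: "integrable M g"
  shows "cond_exp_error (\<lambda>x. f x + g x) n \<le> cond_exp_error f n + cond_exp_error g n"
proof -
  interpret sigma_finite_subalgebra M "F n" by (rule sigma_finite_subalgebra_F)
  note [simp] = integrable_cond_exp_F f g
  have "cond_exp_error (\<lambda>x. f x + g x) n \<le>
      (\<integral>x. \<bar>f x - real_cond_exp M (F n) f x\<bar> + \<bar>g x - real_cond_exp M (F n) g x\<bar> \<partial>M)"
    unfolding cond_exp_error_def
  proof (rule integral_mono_AE)
    show "AE x in M. \<bar>f x + g x - real_cond_exp M (F n) (\<lambda>x. f x + g x) x\<bar>
      \<le> \<bar>f x - real_cond_exp M (F n) f x\<bar> + \<bar>g x - real_cond_exp M (F n) g x\<bar>"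
      using real_cond_exp_add[OF f g] by eventually_elim linarith
  qed simp_all
  also have "\<dots> = cond_exp_error f n + cond_exp_error g n"
    by (simp add: cond_exp_error_def)
  finally show ?thesis .
qed

lemma cond_exp_error_cmult:
  assumes f: "integrable M f"
  shows "cond_exp_error (\<lambda>x. c * f x) n = \<bar>c\<bar> * cond_exp_error f n"
proof -
  interpret sigma_finite_subalgebra M "F n" by (rule sigma_finite_subalgebra_F)
  have "cond_exp_error (\<lambda>x. c * f x) n = (\<integral>x. \<bar>c\<bar> * \<bar>f x - real_cond_exp M (F n) f x\<bar> \<partial>M)"
    unfolding cond_exp_error_def
  proof (rule integral_cong_AE)
    show "AE x in M. \<bar>c * f x - real_cond_exp M (F n) (\<lambda>x. c * f x) x\<bar>
        = \<bar>c\<bar> * \<bar>f x - real_cond_exp M (F n) f x\<bar>"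
      using real_cond_exp_cmult[OF f, of c]
      by eventually_elim (simp flip: abs_mult add: algebra_simps)
  qed (use f in simp_all)
  then show ?thesis by (simp add: cond_exp_error_def)
qed

lemma cond_exp_error_le:
  assumes f: "integrable M f"
  shows "cond_exp_error f n \<le> 2 * (\<integral>x. \<bar>f x\<bar> \<partial>M)"
proof -
  interpret sigma_finite_subalgebra M "F n" by (rule sigma_finite_subalgebra_F)
  note [simp] = integrable_cond_exp_F f
  have "cond_exp_error f n \<le> (\<integral>x. \<bar>f x\<bar> + \<bar>real_cond_exp M (F n) f x\<bar> \<partial>M)"
    unfolding cond_exp_error_def by (intro integral_mono) auto
  also have "\<dots> \<le> 2 * (\<integral>x. \<bar>f x\<bar> \<partial>M)"
    using real_cond_exp_contraction[OF f] by simp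
  finally show ?thesis .
qed

lemma cond_exp_error_F_meas:
  assumes "integrable M f" "f \<in> borel_measurable (F m)" "m \<le> n"
  shows "cond_exp_error f n = 0"
proof -
  interpret sigma_finite_subalgebra M "F n" by (rule sigma_finite_subalgebra_F)
  have "AE x in M. real_cond_exp M (F n) f x = f x"
    by (intro real_cond_exp_F_meas assms measurable_F_mono[OF assms(3,2)])
  then have "cond_exp_error f n = (\<integral>x. 0 \<partial>M)"
    unfolding cond_exp_error_def using assms(1) by (intro integral_cong_AE) auto
  then show ?thesis by simp
qed

lemma cond_exp_error_tendsto_add:
  assumes "integrable M f" "integrable M g"
    and "cond_exp_error f \<longlonglongrightarrow> 0" "cond_exp_error g \<longlonglongrightarrow> 0"
  shows "cond_exp_error (\<lambda>x. f x + g x) \<longlonglongrightarrow> 0"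
proof (rule tendsto_sandwich[of "\<lambda>_. 0"])
  show "(\<lambda>n. cond_exp_error f n + cond_exp_error g n) \<longlonglongrightarrow> 0"
    using tendsto_add[OF assms(3,4)] by simp
qed (use cond_exp_error_add[OF assms(1,2)] in \<open>auto simp: cond_exp_error_nonneg\<close>)

lemma cond_exp_error_tendsto_cmult:
  assumes "integrable M f" "cond_exp_error f \<longlonglongrightarrow> 0"
  shows "cond_exp_error (\<lambda>x. c * f x) \<longlonglongrightarrow> 0"
  using tendsto_mult_right_zero[OF assms(2)] by (subst cond_exp_error_cmult[OF assms(1), abs_def])

text \<open>
  The error of \<open>f\<close> exceeds that of \<open>s i\<close> by at most \<open>2 \<parallel>f - s i\<parallel>\<^sub>1\<close>, uniformly in the index of the filtration.
\<close>
lemma cond_exp_error_tendsto_L1_limit: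
  assumes s: "\<And>i. integrable M (s i)" and f: "integrable M f"
    and conv: "\<And>i. cond_exp_error (s i) \<longlonglongrightarrow> 0"
    and lim: "(\<lambda>i. \<integral>x. \<bar>f x - s i x\<bar> \<partial>M) \<longlonglongrightarrow> 0"
  shows "cond_exp_error f \<longlonglongrightarrow> 0"
proof (rule LIMSEQ_I)
  fix r :: real assume r: "0 < r"
  obtain i where i: "(\<integral>x. \<bar>f x - s i x\<bar> \<partial>M) < r / 4"
    using order_tendstoD(2)[OF lim, of "r / 4"] r by (auto simp: eventually_sequentially)
  obtain n0 where n0: "\<And>n. n \<ge> n0 \<Longrightarrow> cond_exp_error (s i) n < r / 2"
    using order_tendstoD(2)[OF conv, of "r / 2" i] r by (auto simp: eventually_sequentially)
  have "cond_exp_error f n < r" if n: "n \<ge> n0" for n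
  proof -
    have "cond_exp_error f n \<le> cond_exp_error (s i) n + cond_exp_error (\<lambda>x. f x - s i x) n"
      using cond_exp_error_add[OF s[of i], of "\<lambda>x. f x - s i x" n] f s by simp
    moreover have "cond_exp_error (\<lambda>x. f x - s i x) n \<le> 2 * (\<integral>x. \<bar>f x - s i x\<bar> \<partial>M)"
      using f s by (intro cond_exp_error_le) simp
    ultimately show ?thesis using i n0[OF n] by linarith
  qed
  then show "\<exists>no. \<forall>n\<ge>no. norm (cond_exp_error f n - 0) < r"
    by (auto simp: cond_exp_error_nonneg)
qed

lemma cond_exp_error_tendsto_cong:
  assumes "cond_exp_error f \<longlonglongrightarrow> 0" "integrable M f" "integrable M g" "\<And>x. x \<in> space M \<Longrightarrow> f x = g x"
  shows "cond_exp_error g \<longlonglongrightarrow> 0"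
proof (rule cond_exp_error_tendsto_L1_limit[of "\<lambda>_. f"])
  have "(\<integral>x. \<bar>g x - f x\<bar> \<partial>M) = (\<integral>x. 0 \<partial>M)"
    by (intro Bochner_Integration.integral_cong) (auto simp: assms(4))
  then show "(\<lambda>i. \<integral>x. \<bar>g x - f x\<bar> \<partial>M) \<longlonglongrightarrow> 0" by simp
qed (use assms in auto)

text \<open>
  The sets \<open>A\<close> with this property form a Dynkin system, and it contains the intersection-stable
  union of the filtration, whose members have error 0 from some index on.
\<close>
lemma cond_exp_error_tendsto_indicator:
  assumes A: "A \<in> sigma_sets (space M) (\<Union>n. sets (F n))"
  shows "cond_exp_error (indicator A) \<longlonglongrightarrow> 0"
proof -
  have sub: "sigma_sets (space M) (\<Union>n. sets (F n)) \<subseteq> sets M"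
    using sets_F_sub by (intro sets.sigma_sets_subset) auto
  have stable: "Int_stable (\<Union>n. sets (F n))"
    unfolding Int_stable_def
  proof safe
    fix a b i j assume "a \<in> sets (F i)" "b \<in> sets (F j)"
    then have "a \<in> sets (F (max i j))" "b \<in> sets (F (max i j))"
      using sets_F_mono[of i "max i j"] sets_F_mono[of j "max i j"] by auto
    then show "a \<inter> b \<in> (\<Union>n. sets (F n))" by blast
  qed
  have closed: "(\<Union>n. sets (F n)) \<subseteq> Pow (space M)"
    using sets_F_sub sets.sets_into_space by blast
  have int: "integrable M (indicator B :: _ \<Rightarrow> real)" if "B \<in> sets M" for B
    using that by (intro integrable_const_bound[of _ 1]) (auto split: split_indicator)
  have basic: "cond_exp_error (indicator B) \<longlonglongrightarrow> 0" if B: "B \<in> sets (F m)" for B m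
  proof (rule tendsto_eventually)
    show "\<forall>\<^sub>F n in sequentially. cond_exp_error (indicator B) n = 0"
      using eventually_ge_at_top[of m]
      by eventually_elim (rule cond_exp_error_F_meas[of _ m], use B in \<open>auto intro: int sets_F_sub\<close>)
  qed
  show ?thesis
    using stable closed A
  proof (induction rule: sigma_sets_induct_disjoint)
    case (basic A)
    then show ?case using \<open>\<And>m B. B \<in> sets (F m) \<Longrightarrow> cond_exp_error (indicator B) \<longlonglongrightarrow> 0\<close> by auto
  next
    case empty
    show ?case by (rule basic[of _ 0]) auto
  next
    case (compl A)
    then have [measurable]: "A \<in> sets M" using sub by auto
    have [simp]: "integrable M (indicator A :: _ \<Rightarrow> real)" by (rule int) measurable
    have "cond_exp_error (\<lambda>x. indicator (space M) x + (-1) * indicator A x) \<longlonglongrightarrow> 0"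
      using compl basic[of "space M" 0] sets.top[of "F 0"]
      by (intro cond_exp_error_tendsto_add cond_exp_error_tendsto_cmult int) (auto simp: space_F intro!: int)
    then show ?case
      by (rule cond_exp_error_tendsto_cong) (auto intro!: int split: split_indicator)
  next
    case (union A)
    then have [measurable]: "\<And>i. A i \<in> sets M" using sub by auto
    have fin: "cond_exp_error (\<lambda>x. \<Sum>i<k. indicator (A i) x) \<longlonglongrightarrow> 0" for k
    proof (induction k)
      case 0
      have "cond_exp_error (indicator {}) \<longlonglongrightarrow> 0" by (rule basic[of _ 0]) auto
      moreover have "indicator {} = (\<lambda>x::'b. 0::real)" by auto
      ultimately show ?case by simp
    next
      case (Suc k)
      then show ?case
        using union by (auto intro!: cond_exp_error_tendsto_add int Bochner_Integration.integrable_sum)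
    qed
    show ?case
    proof (rule cond_exp_error_tendsto_L1_limit[OF _ _ fin])
      have eq: "(\<lambda>k. \<Sum>i<k. indicator (A i) x :: real) \<longlonglongrightarrow> indicator (\<Union>i. A i) x" for x
        using indicator_sums[of A x] union(1) unfolding sums_def disjoint_family_on_def by auto
      have "(\<lambda>k. \<integral>x. \<bar>indicator (\<Union>i. A i) x - (\<Sum>i<k. indicator (A i) x)\<bar> \<partial>M) \<longlonglongrightarrow> (\<integral>x. (0::real) \<partial>M)"
      proof (rule integral_dominated_convergence[where w="\<lambda>_. 1"])
        show "AE x in M. (\<lambda>k. \<bar>indicator (\<Union>i. A i) x - (\<Sum>i<k. indicator (A i) x)\<bar>) \<longlonglongrightarrow> (0::real)"
          using tendsto_rabs_zero[OF LIM_zero, OF eq] by (simp add: abs_minus_commute)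
        show "AE x in M. norm \<bar>indicat_real (\<Union>i. A i) x - (\<Sum>i<k. indicator (A i) x)\<bar> \<le> (1::real)" for k
        proof (rule AE_I2)
          fix x
          have d: "disjoint_family_on A {..<k}" using union(1) by (auto simp: disjoint_family_on_def)
          have eq: "(\<Sum>i<k. indicator (A i) x :: real) = indicator (\<Union>i<k. A i) x"
            by (simp add: indicator_UN_disjoint d)
          show "norm \<bar>indicat_real (\<Union>i. A i) x - (\<Sum>i<k. indicator (A i) x)\<bar> \<le> (1::real)"
            unfolding eq by (simp split: split_indicator)
        qed
      qed auto
      then show "(\<lambda>k. \<integral>x. \<bar>indicator (\<Union>i. A i) x - (\<Sum>i<k. indicator (A i) x)\<bar> \<partial>M) \<longlonglongrightarrow> (0::real)" by simp
    qed (auto intro!: int)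
  qed
qed

text \<open>
  Integrable functions are \<open>L\<^sup>1\<close>-limits of simple ones, so the case of indicators suffices.
\<close>
theorem Levy_upward_L1:
  assumes gen: "sets M = sigma_sets (space M) (\<Union>n. sets (F n))" and f: "integrable M f"
  shows "(\<lambda>n. \<integral>x. \<bar>f x - real_cond_exp M (F n) f x\<bar> \<partial>M) \<longlonglongrightarrow> 0"
proof -
  have "cond_exp_error f \<longlonglongrightarrow> 0"
    using f
  proof (induction rule: integrable_induct)
    case (base A c)
    have "cond_exp_error (\<lambda>x. c * indicator A x) \<longlonglongrightarrow> 0"
      using base gen by (intro cond_exp_error_tendsto_cmult cond_exp_error_tendsto_indicator) auto
    then show ?case by (simp add: mult.commute)
  next
    case (add f g)
    then show ?case by (intro cond_exp_error_tendsto_add)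
  next
    case (lim f s)
    show ?case
      by (rule cond_exp_error_tendsto_L1_limit[OF lim(1,4,5)])
         (rule dominated_L1_convergence[OF lim(1,4,2,3)])
  qed
  then show ?thesis by (simp add: cond_exp_error_def[abs_def])
qed

end

section \<open>Almost sure convergence of martingales bounded in L2\<close>
context filtered_prob_space
begin

context
  fixes X :: "nat \<Rightarrow> 'b \<Rightarrow> real" and b :: "nat \<Rightarrow> real"
  assumes adapted: "\<And>n. X n \<in> borel_measurable (F n)"
    and bounded: "\<And>n. AE x in M. \<bar>X n x\<bar> \<le> b n"
    and martingale: "\<And>n. AE x in M. real_cond_exp M (F n) (X (Suc n)) x = X n x"
begin

lemma adapted_measurable: "X n \<in> borel_measurable M"
  using measurable_F[OF adapted] .

lemma increment_square_integrable: "integrable M (\<lambda>x. (X i x - X l x)\<^sup>2)"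
proof (rule integrable_const_bound)
  show "AE x in M. norm ((X i x - X l x)\<^sup>2) \<le> (\<bar>b i\<bar> + \<bar>b l\<bar>)\<^sup>2"
    using bounded[of i] bounded[of l]
  proof eventually_elim
    case (elim x)
    then have "\<bar>X i x - X l x\<bar> \<le> \<bar>b i\<bar> + \<bar>b l\<bar>" by linarith
    then show ?case by (simp add: power2_le_iff_abs_le)
  qed
qed (intro borel_measurable_power borel_measurable_diff adapted_measurable)

text \<open>
  The one-step martingale property, iterated and tested against a bounded function known at time \<open>n\<close>.
\<close>
lemma martingale_test_function:
  assumes g: "g \<in> borel_measurable (F n)" and bd: "AE x in M. \<bar>g x\<bar> \<le> c" and "n \<le> k"
  shows "integrable M (\<lambda>x. g x * X k x)" "(\<integral>x. g x * X k x \<partial>M) = (\<integral>x. g x * X n x \<partial>M)"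
proof -
  note [measurable] = adapted_measurable
  have [measurable]: "g \<in> borel_measurable M" by (rule measurable_F[OF g])
  show int: "integrable M (\<lambda>x. g x * X k x)" for k
  proof (rule integrable_const_bound)
    show "AE x in M. norm (g x * X k x) \<le> \<bar>c\<bar> * \<bar>b k\<bar>"
      using bd bounded[of k] by eventually_elim (auto simp: abs_mult intro!: mult_mono)
  qed measurable
  show "(\<integral>x. g x * X k x \<partial>M) = (\<integral>x. g x * X n x \<partial>M)"
    using \<open>n \<le> k\<close>
  proof (induction k rule: dec_induct)
    case (step k)
    interpret sigma_finite_subalgebra M "F k" by (rule sigma_finite_subalgebra_F)
    have "(\<integral>x. g x * X (Suc k) x \<partial>M) = (\<integral>x. g x * real_cond_exp M (F k) (X (Suc k)) x \<partial>M)"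
      using step(1) by (intro real_cond_exp_intg(2)[symmetric] int measurable_F_mono[OF _ g]) auto
    also have "\<dots> = (\<integral>x. g x * X k x \<partial>M)"
      using martingale[of k] by (intro integral_cong_AE) auto
    finally show ?case using step by simp
  qed simp
qed

text \<open>
  Expand \<open>(X\<^sub>k - X\<^sub>m)\<^sup>2\<close> around \<open>X\<^sub>j\<close>: the mixed term integrates to 0 over \<open>A\<close>, since
  \<open>1\<^sub>A (X\<^sub>j - X\<^sub>m)\<close> is known at time \<open>j\<close>, and the remaining square is nonnegative.
\<close>
lemma martingale_increment_orthogonal:
  assumes A: "A \<in> sets (F j)" and "m \<le> j" "j \<le> k"
  shows "(\<integral>x. indicator A x * (X j x - X m x)\<^sup>2 \<partial>M) \<le> (\<integral>x. indicator A x * (X k x - X m x)\<^sup>2 \<partial>M)"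
proof -
  note [measurable] = adapted_measurable
  have [measurable]: "A \<in> sets M" by (rule sets_F_sub[OF A])
  have int: "integrable M (\<lambda>x. indicator A x * (X i x - X l x)\<^sup>2)" for i l
    using integrable_mult_indicator[OF sets_F_sub[OF A] increment_square_integrable] by simp
  define g where "g x = indicator A x * (X j x - X m x)" for x
  have g: "g \<in> borel_measurable (F j)"
    using A adapted[of j] measurable_F_mono[OF \<open>m \<le> j\<close> adapted] unfolding g_def by measurable
  have gb: "AE x in M. \<bar>g x\<bar> \<le> \<bar>b j\<bar> + \<bar>b m\<bar>"
    using bounded[of j] bounded[of m] by eventually_elim (auto simp: g_def split: split_indicator)
  have gint: "integrable M (\<lambda>x. g x * X k x)" "integrable M (\<lambda>x. g x * X j x)"
    using martingale_test_function(1)[OF g gb] \<open>j \<le> k\<close> by auto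
  have "(\<integral>x. indicator A x * (X j x - X m x)\<^sup>2 \<partial>M)
      = (\<integral>x. indicator A x * (X j x - X m x)\<^sup>2 + 2 * (g x * X k x - g x * X j x) \<partial>M)"
    using martingale_test_function(2)[OF g gb \<open>j \<le> k\<close>] gint int by simp
  also have "\<dots> \<le> (\<integral>x. indicator A x * (X k x - X m x)\<^sup>2 \<partial>M)"
  proof (rule integral_mono)
    show "indicator A x * (X j x - X m x)\<^sup>2 + 2 * (g x * X k x - g x * X j x) \<le> indicator A x * (X k x - X m x)\<^sup>2" for x
      using zero_le_power2[of "X k x - X j x"]
      by (auto simp: g_def power2_eq_square algebra_simps split: split_indicator)
  qed (use gint int in auto)
  finally show ?thesis .
qed

lemma martingale_second_moments:
  assumes "m \<le> k"
  shows "(\<integral>x. (X k x - X m x)\<^sup>2 \<partial>M) = (\<integral>x. (X k x)\<^sup>2 \<partial>M) - (\<integral>x. (X m x)\<^sup>2 \<partial>M)"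
proof -
  note [measurable] = adapted_measurable
  have int: "integrable M (\<lambda>x. (X i x)\<^sup>2)" for i
  proof (rule integrable_const_bound)
    show "AE x in M. norm ((X i x)\<^sup>2) \<le> (b i)\<^sup>2"
      using bounded[of i] by eventually_elim (metis abs_ge_zero power2_abs power_mono real_norm_def abs_power2)
  qed measurable
  have "(\<integral>x. (X k x - X m x)\<^sup>2 \<partial>M) = (\<integral>x. (X k x)\<^sup>2 + (X m x)\<^sup>2 - 2 * (X m x * X k x) \<partial>M)"
    by (intro Bochner_Integration.integral_cong) (auto simp: power2_eq_square algebra_simps)
  also have "\<dots> = (\<integral>x. (X k x)\<^sup>2 \<partial>M) + (\<integral>x. (X m x)\<^sup>2 \<partial>M) - 2 * (\<integral>x. X m x * X k x \<partial>M)"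
    using int martingale_test_function(1)[OF adapted bounded assms] by simp
  also have "(\<integral>x. X m x * X k x \<partial>M) = (\<integral>x. (X m x)\<^sup>2 \<partial>M)"
    using martingale_test_function(2)[OF adapted bounded assms] by (simp add: power2_eq_square)
  finally show ?thesis by simp
qed

text \<open>
  Kolmogorov's inequality. Split the event by the first time \<open>j\<close> at which the deviation reaches
  \<open>\<epsilon>\<close>. That part is known at time \<open>j\<close>, so its share of the second moment can only grow until time \<open>k\<close>.
\<close>
lemma martingale_maximal_inequality:
  assumes "m \<le> k" "0 < \<epsilon>"
  shows "\<epsilon>\<^sup>2 * prob {x\<in>space M. \<exists>j\<in>{m..k}. \<epsilon> \<le> \<bar>X j x - X m x\<bar>}
    \<le> (\<integral>x. (X k x)\<^sup>2 \<partial>M) - (\<integral>x. (X m x)\<^sup>2 \<partial>M)"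
proof -
  note [measurable] = adapted_measurable
  \<comment> \<open>first passage at time j\<close>
  define A where "A j = {x\<in>space M. \<epsilon> \<le> \<bar>X j x - X m x\<bar> \<and> (\<forall>i\<in>{m..<j}. \<bar>X i x - X m x\<bar> < \<epsilon>)}" for j
  have AF: "A j \<in> sets (F j)" if "m \<le> j" for j
  proof -
    have [measurable]: "X j \<in> borel_measurable (F j)" "X m \<in> borel_measurable (F j)"
      using adapted measurable_F_mono[OF that adapted] by auto
    have [measurable]: "X i \<in> borel_measurable (F j)" if "i \<in> {m..<j}" for i
      using that by (intro measurable_F_mono[OF _ adapted]) auto
    show ?thesis unfolding A_def space_F[symmetric, of j] by measurable
  qed
  have AM[measurable]: "A j \<in> sets M" if "m \<le> j" for j using sets_F_sub[OF AF[OF that]] .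
  have disj: "disjoint_family_on A {m..k}"
    unfolding disjoint_family_on_def A_def by (auto simp: not_less[symmetric] Ball_def) (metis linorder_neqE_nat not_less)
  have Un: "{x\<in>space M. \<exists>j\<in>{m..k}. \<epsilon> \<le> \<bar>X j x - X m x\<bar>} = (\<Union>j\<in>{m..k}. A j)"
  proof (intro set_eqI iffI)
    fix x assume "x \<in> {x\<in>space M. \<exists>j\<in>{m..k}. \<epsilon> \<le> \<bar>X j x - X m x\<bar>}"
    then obtain j where j: "x \<in> space M" "m \<le> j" "j \<le> k" "\<epsilon> \<le> \<bar>X j x - X m x\<bar>" by auto
    define i where "i = (LEAST i. m \<le> i \<and> \<epsilon> \<le> \<bar>X i x - X m x\<bar>)"
    have "m \<le> i \<and> \<epsilon> \<le> \<bar>X i x - X m x\<bar>" "i \<le> j"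
      using j unfolding i_def by (auto intro: LeastI2_ex Least_le)
    moreover have "\<bar>X l x - X m x\<bar> < \<epsilon>" if "l \<in> {m..<i}" for l
      using not_less_Least[of l "\<lambda>i. m \<le> i \<and> \<epsilon> \<le> \<bar>X i x - X m x\<bar>"] that unfolding i_def by auto
    ultimately show "x \<in> (\<Union>j\<in>{m..k}. A j)" using j by (auto simp: A_def)
  qed (auto simp: A_def)
  have intA: "integrable M (\<lambda>x. indicator (A j) x * (X i x - X l x)\<^sup>2)" if "m \<le> j" for i j l
    using integrable_mult_indicator[OF AM[OF that] increment_square_integrable] by simp
  have step: "\<epsilon>\<^sup>2 * prob (A j) \<le> (\<integral>x. indicator (A j) x * (X k x - X m x)\<^sup>2 \<partial>M)" if j: "j \<in> {m..k}" for j
  proof -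
    have "\<epsilon>\<^sup>2 * prob (A j) = (\<integral>x. indicator (A j) x * \<epsilon>\<^sup>2 \<partial>M)"
      using j by simp
    also have "\<dots> \<le> (\<integral>x. indicator (A j) x * (X j x - X m x)\<^sup>2 \<partial>M)"
    proof (rule integral_mono)
      fix x
      show "indicator (A j) x * \<epsilon>\<^sup>2 \<le> indicator (A j) x * (X j x - X m x)\<^sup>2"
        using \<open>0 < \<epsilon>\<close> by (auto simp: A_def abs_le_square_iff[symmetric] split: split_indicator)
      show "integrable M (\<lambda>x. indicator (A j) x * \<epsilon>\<^sup>2)"
        using j by (intro integrable_const_bound[of _ "\<epsilon>\<^sup>2"]) (auto split: split_indicator)
    qed (use j intA in auto)
    also have "\<dots> \<le> (\<integral>x. indicator (A j) x * (X k x - X m x)\<^sup>2 \<partial>M)"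
      using j by (intro martingale_increment_orthogonal AF) auto
    finally show ?thesis .
  qed
  have "\<epsilon>\<^sup>2 * prob (\<Union>j\<in>{m..k}. A j) = (\<Sum>j\<in>{m..k}. \<epsilon>\<^sup>2 * prob (A j))"
    using disj by (subst finite_measure_finite_Union) (auto simp: sum_distrib_left)
  also have "\<dots> \<le> (\<Sum>j\<in>{m..k}. \<integral>x. indicator (A j) x * (X k x - X m x)\<^sup>2 \<partial>M)"
    by (intro sum_mono step)
  also have "\<dots> = (\<integral>x. (\<Sum>j\<in>{m..k}. indicator (A j) x * (X k x - X m x)\<^sup>2) \<partial>M)"
    by (subst Bochner_Integration.integral_sum) (auto intro: intA)
  also have "\<dots> \<le> (\<integral>x. (X k x - X m x)\<^sup>2 \<partial>M)"
  proof (rule integral_mono)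
    fix x
    have "(\<Sum>j\<in>{m..k}. indicator (A j) x * (X k x - X m x)\<^sup>2) = indicator (\<Union>j\<in>{m..k}. A j) x * (X k x - X m x)\<^sup>2"
      using disj by (simp add: indicator_UN_disjoint sum_distrib_right)
    then show "(\<Sum>j\<in>{m..k}. indicator (A j) x * (X k x - X m x)\<^sup>2) \<le> (X k x - X m x)\<^sup>2"
      unfolding \<open>(\<Sum>j\<in>{m..k}. indicator (A j) x * (X k x - X m x)\<^sup>2) = _\<close>
      by (simp split: split_indicator)
    show "integrable M (\<lambda>x. \<Sum>j\<in>{m..k}. indicator (A j) x * (X k x - X m x)\<^sup>2)"
      by (rule Bochner_Integration.integrable_sum) (simp add: intA)
  qed (rule increment_square_integrable)
  also have "\<dots> = (\<integral>x. (X k x)\<^sup>2 \<partial>M) - (\<integral>x. (X m x)\<^sup>2 \<partial>M)"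
    by (rule martingale_second_moments[OF assms(1)])
  finally show ?thesis unfolding Un .
qed

text \<open>
  The second moments increase to a finite limit \<open>L\<close>. The maximal inequality therefore bounds the
  probability of an \<open>\<epsilon>\<close>-oscillation after time \<open>m\<close> by a quantity that vanishes as \<open>m\<close> grows, and so
  almost every path is Cauchy.
\<close>
theorem L2_bounded_martingale_convergent:
  assumes K: "\<And>n. (\<integral>x. (X n x)\<^sup>2 \<partial>M) \<le> K"
  shows "AE x in M. convergent (\<lambda>n. X n x)"
proof -
  note [measurable] = adapted_measurable
  define s where "s n = (\<integral>x. (X n x)\<^sup>2 \<partial>M)" for n
  have "incseq s"
    unfolding incseq_def s_def
  proof (intro allI impI)
    fix m k :: nat assume "m \<le> k"
    then show "(\<integral>x. (X m x)\<^sup>2 \<partial>M) \<le> (\<integral>x. (X k x)\<^sup>2 \<partial>M)"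
      using martingale_second_moments[of m k] integral_nonneg_AE[of "\<lambda>x. (X k x - X m x)\<^sup>2" M] by simp
  qed
  then obtain L where L: "s \<longlonglongrightarrow> L" "\<And>n. s n \<le> L"
    using incseq_convergent[of s K] K by (auto simp: s_def)
  \<comment> \<open>let the horizon k in the maximal inequality tend to infinity\<close>
  have tail: "prob {x\<in>space M. \<exists>j\<ge>m. \<epsilon> \<le> \<bar>X j x - X m x\<bar>} \<le> (L - s m) / \<epsilon>\<^sup>2" if "0 < \<epsilon>" for m \<epsilon>
  proof (rule LIMSEQ_le_const2)
    let ?U = "\<lambda>k. {x\<in>space M. \<exists>j\<in>{m..k}. \<epsilon> \<le> \<bar>X j x - X m x\<bar>}"
    have "(\<lambda>k. prob (?U k)) \<longlonglongrightarrow> prob (\<Union>k. ?U k)"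
    proof (rule finite_Lim_measure_incseq)
      show "range ?U \<subseteq> sets M" by (rule image_subsetI) measurable
      show "incseq ?U" unfolding incseq_def by (auto intro: order_trans)
    qed
    also have "(\<Union>k. ?U k) = {x\<in>space M. \<exists>j\<ge>m. \<epsilon> \<le> \<bar>X j x - X m x\<bar>}"
      by (auto, metis atLeastAtMost_iff order_refl)
    finally show "(\<lambda>k. prob (?U k)) \<longlonglongrightarrow> prob {x\<in>space M. \<exists>j\<ge>m. \<epsilon> \<le> \<bar>X j x - X m x\<bar>}" .
    have "prob (?U k) \<le> (L - s m) / \<epsilon>\<^sup>2" if "m \<le> k" for k
      using martingale_maximal_inequality[OF that \<open>0 < \<epsilon>\<close>] L(2)[of k] \<open>0 < \<epsilon>\<close>
      by (simp add: s_def field_simps)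
    then show "\<exists>N. \<forall>k\<ge>N. prob (?U k) \<le> (L - s m) / \<epsilon>\<^sup>2" by auto
  qed
  have "AE x in M. \<exists>m. \<forall>j\<ge>m. \<bar>X j x - X m x\<bar> < \<epsilon>" if "0 < \<epsilon>" for \<epsilon>
  proof -
    let ?B = "{x\<in>space M. \<forall>m. \<exists>j\<ge>m. \<epsilon> \<le> \<bar>X j x - X m x\<bar>}"
    have "prob ?B \<le> (L - s m) / \<epsilon>\<^sup>2" for m
      by (rule order_trans[OF finite_measure_mono tail[OF that]]) auto
    moreover have "(\<lambda>m. (L - s m) / \<epsilon>\<^sup>2) \<longlonglongrightarrow> (L - L) / \<epsilon>\<^sup>2"
      by (intro tendsto_intros L(1)) (use that in auto)
    ultimately have "prob ?B \<le> 0"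
      by (intro LIMSEQ_le_const[of "\<lambda>m. (L - s m) / \<epsilon>\<^sup>2"]) auto
    then have "prob ?B = 0" by (simp add: measure_le_0_iff)
    then have "AE x in M. x \<notin> ?B" by (intro AE_not_in) (auto simp: null_sets_def emeasure_eq_measure)
    then show ?thesis using AE_space by eventually_elim (force simp: not_le)
  qed
  then have "AE x in M. \<forall>r::nat. \<exists>m. \<forall>j\<ge>m. \<bar>X j x - X m x\<bar> < 1 / real (Suc r)"
    by (simp add: AE_all_countable)
  then show ?thesis
  proof eventually_elim
    case (elim x)
    have "Cauchy (\<lambda>n. X n x)"
      unfolding Cauchy_altdef2 dist_real_def
    proof safe
      fix e :: real assume "0 < e"
      then obtain r where "inverse (real (Suc r)) < e" using reals_Archimedean by blast
      then show "\<exists>N. \<forall>n\<ge>N. \<bar>X n x - X N x\<bar> < e"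
        using elim[rule_format, of r] by (metis inverse_eq_divide less_trans)
    qed
    then show ?case by (simp add: Cauchy_convergent_iff)
  qed
qed

end

end

section \<open>Stable convergence under a change of measure\<close>
lemma integral_uniform_measure:
  fixes f :: "'b \<Rightarrow> real"
  assumes "prob_space R" and H: "H \<in> sets R" "0 < measure R H" and f[measurable]: "f \<in> borel_measurable R"
  shows "(\<integral>x. f x \<partial>uniform_measure R H) = (\<integral>x. indicator H x * f x \<partial>R) / measure R H"
proof -
  interpret prob_space R by fact
  have "uniform_measure R H = density R (\<lambda>x. ennreal (indicator H x / measure R H))"
    unfolding uniform_measure_def using H
    by (intro arg_cong[where f="density R"] ext)
       (simp add: emeasure_eq_measure divide_ennreal ennreal_indicator[symmetric])
  then have "(\<integral>x. f x \<partial>uniform_measure R H) = (\<integral>x. (indicator H x / measure R H) *\<^sub>R f x \<partial>R)"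
    using H by (simp only:) (rule integral_density, auto)
  then show ?thesis by (simp add: field_simps)
qed

text \<open>
  The integral of a test function against a random probability measure is a random variable with
  values in \<open>[0, 1]\<close>. Test functions are restricted to this range because the mixture is computed
  through nonnegative integrals, and the step functions that determine weak convergence lie in it.
\<close>
lemma kernel_integral:
  fixes g :: "real \<Rightarrow> real"
  assumes N: "N \<in> M \<rightarrow>\<^sub>M prob_algebra borel" and g[measurable]: "g \<in> borel_measurable borel"
    and g01: "\<And>y. 0 \<le> g y" "\<And>y. g y \<le> 1"
  shows "(\<lambda>x. \<integral>y. g y \<partial>N x) \<in> borel_measurable M"
    and "\<And>x. x \<in> space M \<Longrightarrow> ennreal (\<integral>y. g y \<partial>N x) = (\<integral>\<^sup>+y. g y \<partial>N x)"
    and "\<And>x. 0 \<le> (\<integral>y. g y \<partial>N x)" and "\<And>x. x \<in> space M \<Longrightarrow> (\<integral>y. g y \<partial>N x) \<le> 1"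
proof -
  have Ns[measurable]: "N \<in> M \<rightarrow>\<^sub>M subprob_algebra borel" by (rule measurable_prob_algebraD[OF N])
  show nn: "0 \<le> (\<integral>y. g y \<partial>N x)" for x by (intro integral_nonneg_AE) (auto simp: g01)
  have px: "prob_space (N x)" "sets (N x) = sets borel" if "x \<in> space M" for x
    using measurable_space[OF N that] by (auto simp: space_prob_algebra)
  have int: "integrable (N x) g" if "x \<in> space M" for x
  proof -
    interpret prob_space "N x" by (rule px[OF that])
    have "g \<in> borel_measurable (N x)"
      using g measurable_cong_sets[OF px(2)[OF that] refl] by blast
    then show ?thesis
      using g01 by (intro integrable_const_bound[of _ 1]) auto
  qed
  show eq: "ennreal (\<integral>y. g y \<partial>N x) = (\<integral>\<^sup>+y. g y \<partial>N x)" if "x \<in> space M" for x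
    by (rule nn_integral_eq_integral[symmetric, OF int[OF that]]) (auto simp: g01)
  show "(\<integral>y. g y \<partial>N x) \<le> 1" if "x \<in> space M" for x
  proof -
    interpret prob_space "N x" by (rule px[OF that])
    have "(\<integral>y. g y \<partial>N x) \<le> (\<integral>y. 1 \<partial>N x)"
      using int[OF that] g01 by (intro integral_mono) auto
    then show ?thesis by (simp add: prob_space)
  qed
  have "(\<lambda>x. enn2real (\<integral>\<^sup>+y. g y \<partial>N x)) \<in> borel_measurable M"
    using measurable_compose[OF Ns nn_integral_measurable_subprob_algebra[of "\<lambda>y. ennreal (g y)" borel]] by simp
  then show "(\<lambda>x. \<integral>y. g y \<partial>N x) \<in> borel_measurable M"
    by (rule measurable_cong[THEN iffD1, rotated]) (simp add: eq[symmetric] nn)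
qed

lemma integral_bind_kernel:
  fixes g :: "real \<Rightarrow> real"
  assumes U: "prob_space U" "sets U = sets M" and N: "N \<in> M \<rightarrow>\<^sub>M prob_algebra borel"
    and g[measurable]: "g \<in> borel_measurable borel" and g01: "\<And>y. 0 \<le> g y" "\<And>y. g y \<le> 1"
  shows "(\<integral>y. g y \<partial>(U \<bind> N)) = (\<integral>x. (\<integral>y. g y \<partial>N x) \<partial>U)"
    and "real_distribution (U \<bind> N)"
proof -
  note kern = kernel_integral[OF N g g01]
  have NU: "N \<in> U \<rightarrow>\<^sub>M prob_algebra borel" using N measurable_cong_sets[OF U(2) refl] by blast
  have Ua: "U \<in> space (prob_algebra U)" using U by (simp add: space_prob_algebra)
  have sets: "sets (U \<bind> N) = sets borel" by (rule sets_bind'[OF Ua NU])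
  have prob: "prob_space (U \<bind> N)" by (rule prob_space_bind'[OF Ua NU])
  show "real_distribution (U \<bind> N)"
    using prob sets by (simp add: real_distribution_def real_distribution_axioms_def)
  interpret B: prob_space "U \<bind> N" by fact
  interpret U: prob_space U by fact
  have [measurable]: "g \<in> borel_measurable (U \<bind> N)" using g measurable_cong_sets[OF sets refl] by blast
  have spU: "space U = space M" by (rule sets_eq_imp_space_eq[OF U(2)])
  have [measurable]: "(\<lambda>x. \<integral>y. g y \<partial>N x) \<in> borel_measurable U"
    using kern(1) measurable_cong_sets[OF U(2) refl] by blast
  have "ennreal (\<integral>y. g y \<partial>(U \<bind> N)) = (\<integral>\<^sup>+y. g y \<partial>(U \<bind> N))"
    using g01 by (intro nn_integral_eq_integral[symmetric] B.integrable_const_bound[of _ 1]) auto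
  also have "\<dots> = (\<integral>\<^sup>+x. \<integral>\<^sup>+y. g y \<partial>N x \<partial>U)"
    by (rule nn_integral_bind[of _ borel]) (auto intro: measurable_prob_algebraD[OF NU])
  also have "\<dots> = (\<integral>\<^sup>+x. ennreal (\<integral>y. g y \<partial>N x) \<partial>U)"
    by (intro nn_integral_cong) (simp add: kern(2) spU)
  also have "\<dots> = ennreal (\<integral>x. (\<integral>y. g y \<partial>N x) \<partial>U)"
    using kern by (intro nn_integral_eq_integral U.integrable_const_bound[of _ 1]) (auto simp: spU)
  finally show "(\<integral>y. g y \<partial>(U \<bind> N)) = (\<integral>x. (\<integral>y. g y \<partial>N x) \<partial>U)"
    by (subst (asm) ennreal_inj) (auto intro!: integral_nonneg_AE simp: g01 kern)
qed

lemma prob_space_uniform_measure_of_pos: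
  assumes "prob_space R" "0 < measure R H"
  shows "prob_space (uniform_measure R H)"
proof -
  interpret prob_space R by fact
  show ?thesis using assms(2) by (intro prob_space_uniform_measure) (auto simp: emeasure_eq_measure)
qed

text \<open>
  Both laws in the definition of stable convergence, integrated against a test function, are
  conditional means over \<open>H\<close>.
\<close>
lemma uniform_measure_integrals:
  fixes g :: "real \<Rightarrow> real"
  assumes R: "prob_space R" and H: "H \<in> sets R" "0 < measure R H"
    and Z[measurable]: "Z \<in> borel_measurable R" and N: "N \<in> R \<rightarrow>\<^sub>M prob_algebra borel"
    and g[measurable]: "g \<in> borel_measurable borel" and g01: "\<And>y. 0 \<le> g y" "\<And>y. g y \<le> 1"
  shows "(\<integral>y. g y \<partial>distr (uniform_measure R H) borel Z) = (\<integral>x. indicator H x * g (Z x) \<partial>R) / measure R H"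
    and "(\<integral>y. g y \<partial>(uniform_measure R H \<bind> N)) = (\<integral>x. indicator H x * (\<integral>y. g y \<partial>N x) \<partial>R) / measure R H"
    and "real_distribution (distr (uniform_measure R H) borel Z)"
    and "real_distribution (uniform_measure R H \<bind> N)"
proof -
  note U = prob_space_uniform_measure_of_pos[OF R H(2)] sets_uniform_measure[of R H]
  have ZU: "Z \<in> borel_measurable (uniform_measure R H)" by measurable
  show "(\<integral>y. g y \<partial>distr (uniform_measure R H) borel Z) = (\<integral>x. indicator H x * g (Z x) \<partial>R) / measure R H"
    by (subst integral_distr[OF ZU g]) (rule integral_uniform_measure[OF R H], measurable)
  show "(\<integral>y. g y \<partial>(uniform_measure R H \<bind> N)) = (\<integral>x. indicator H x * (\<integral>y. g y \<partial>N x) \<partial>R) / measure R H"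
    by (subst integral_bind_kernel(1)[OF U N g g01])
       (rule integral_uniform_measure[OF R H kernel_integral(1)[OF N g g01]])
  show "real_distribution (distr (uniform_measure R H) borel Z)"
    by (rule prob_space.real_distribution_distr[OF U(1) ZU])
  show "real_distribution (uniform_measure R H \<bind> N)"
    by (rule integral_bind_kernel(2)[OF U N g g01])
qed

text \<open>
  For \<open>f\<close> an indicator this is the definition of stable convergence, multiplied by the probability of
  the event. Both sides are \<open>L\<^sup>1\<close>-continuous in \<open>f\<close>, uniformly in \<open>n\<close>, because \<open>g\<close> is bounded by 1.
\<close>
lemma stably_converges_weighted:
  fixes g :: "real \<Rightarrow> real"
  assumes R: "prob_space R" and stable: "stably_converges R Z N"
    and Z[measurable]: "\<And>n. Z n \<in> borel_measurable R" and N: "N \<in> R \<rightarrow>\<^sub>M prob_algebra borel"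
    and g: "\<And>y. isCont g y" "\<And>y. 0 \<le> g y" "\<And>y. g y \<le> 1"
    and f: "integrable R f"
  shows "(\<lambda>n. \<integral>x. f x * g (Z n x) \<partial>R) \<longlonglongrightarrow> (\<integral>x. f x * (\<integral>y. g y \<partial>N x) \<partial>R)"
proof -
  interpret prob_space R by fact
  have gm[measurable]: "g \<in> borel_measurable borel"
    using g(1) by (intro borel_measurable_continuous_onI continuous_at_imp_continuous_on) auto
  note kern = kernel_integral[OF N gm g(2,3)]
  note [measurable] = kern(1)
  have abs_g: "\<bar>g y\<bar> \<le> 1" for y using g(2,3)[of y] by simp
  have abs_k: "x \<in> space R \<Longrightarrow> \<bar>\<integral>y. g y \<partial>N x\<bar> \<le> 1" for x using kern(3,4)[of x] by simp
  have int: "integrable R (\<lambda>x. f x * g (Z n x))" "integrable R (\<lambda>x. f x * (\<integral>y. g y \<partial>N x))"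
    if "integrable R f" for f n
    using that by (auto intro!: Bochner_Integration.integrable_bound[OF that] simp: abs_mult
        abs_g abs_k mult_left_le)
  show ?thesis
    using f
  proof (induction rule: integrable_induct)
    case (base A c)
    show ?case
    \<comment> \<open>conditioning on a null event is excluded, but then both sides are 0\<close>
    proof (cases "measure R A = 0")
      case True
      then have "AE x in R. x \<notin> A" using base by (intro AE_not_in) (auto simp: null_sets_def emeasure_eq_measure)
      then have "(\<integral>x. indicator A x *\<^sub>R c * h x \<partial>R) = (\<integral>x. 0 \<partial>R)" if "h \<in> borel_measurable R" for h
        using that base by (intro integral_cong_AE) (auto elim!: eventually_mono)
      then show ?thesis by simp
    next
      case False
      then have pos: "0 < measure R A" by (simp add: zero_less_measure_iff)
      note u = uniform_measure_integrals[OF R base(1) pos _ N gm g(2,3)]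
      have "weak_conv_m (\<lambda>n. distr (uniform_measure R A) borel (Z n)) (uniform_measure R A \<bind> N)"
        using stable base(1) pos by (auto simp: stably_converges_def)
      then have "(\<lambda>n. \<integral>y. g y \<partial>distr (uniform_measure R A) borel (Z n)) \<longlonglongrightarrow> (\<integral>y. g y \<partial>(uniform_measure R A \<bind> N))"
        by (intro weak_conv_imp_integral_bdd_continuous_conv[of _ _ g 1])
           (auto intro: u(3,4)[OF Z] g abs_g)
      then have "(\<lambda>n. c * measure R A * ((\<integral>x. indicator A x * g (Z n x) \<partial>R) / measure R A))
          \<longlonglongrightarrow> c * measure R A * ((\<integral>x. indicator A x * (\<integral>y. g y \<partial>N x) \<partial>R) / measure R A)"
        unfolding u(1)[OF Z] u(2)[OF Z] by (rule tendsto_mult_left)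
      then have "(\<lambda>n. c * (\<integral>x. indicator A x * g (Z n x) \<partial>R)) \<longlonglongrightarrow> c * (\<integral>x. indicator A x * (\<integral>y. g y \<partial>N x) \<partial>R)"
        using False by simp
      then show ?thesis by (simp add: mult.assoc mult.left_commute flip: Bochner_Integration.integral_mult_right_zero)
    qed
  next
    case (add f h)
    then show ?case using int[OF add(1)] int[OF add(2)]
      by (simp add: distrib_right tendsto_add)
  next
    case (lim f s)
    have [measurable]: "\<And>i. s i \<in> borel_measurable R" "f \<in> borel_measurable R" using lim by auto
    have L1: "(\<lambda>i. \<integral>x. \<bar>f x - s i x\<bar> \<partial>R) \<longlonglongrightarrow> 0"
      by (rule dominated_L1_convergence[OF lim(1,4,2,3)])
    have diff: "\<bar>(\<integral>x. f x * h x \<partial>R) - (\<integral>x. s i x * h x \<partial>R)\<bar> \<le> (\<integral>x. \<bar>f x - s i x\<bar> \<partial>R)"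
      if [measurable]: "h \<in> borel_measurable R" and h: "\<And>x. x \<in> space R \<Longrightarrow> \<bar>h x\<bar> \<le> 1" for h i
    proof -
      have ih: "integrable R (\<lambda>x. u x * h x)" if "integrable R u" for u
        using that by (auto intro!: Bochner_Integration.integrable_bound[OF that] simp: abs_mult h mult_left_le)
      have "\<bar>(\<integral>x. f x * h x \<partial>R) - (\<integral>x. s i x * h x \<partial>R)\<bar> = \<bar>\<integral>x. (f x - s i x) * h x \<partial>R\<bar>"
        using ih[OF lim(1)[of i]] ih[OF lim(4)] by (simp add: left_diff_distrib)
      also have "\<dots> \<le> (\<integral>x. \<bar>(f x - s i x) * h x\<bar> \<partial>R)" by (rule integral_abs_bound)
      also have "\<dots> \<le> (\<integral>x. \<bar>f x - s i x\<bar> \<partial>R)"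
        using lim(1)[of i] lim(4) integrable_abs[OF ih[of "\<lambda>x. f x - s i x"]]
        by (intro integral_mono) (auto simp: abs_mult h mult_left_le)
      finally show ?thesis .
    qed
    show ?case
    proof (rule LIMSEQ_I)
      fix r :: real assume r: "0 < r"
      obtain i where i: "(\<integral>x. \<bar>f x - s i x\<bar> \<partial>R) < r / 3"
        using order_tendstoD(2)[OF L1, of "r / 3"] r by (auto simp: eventually_sequentially)
      obtain n0 where n0: "\<And>n. n \<ge> n0 \<Longrightarrow>
          \<bar>(\<integral>x. s i x * g (Z n x) \<partial>R) - (\<integral>x. s i x * (\<integral>y. g y \<partial>N x) \<partial>R)\<bar> < r / 3"
        using LIMSEQ_D[OF lim(5)[of i], of "r / 3"] r by auto
      have "\<bar>(\<integral>x. f x * g (Z n x) \<partial>R) - (\<integral>x. f x * (\<integral>y. g y \<partial>N x) \<partial>R)\<bar> < r" if "n \<ge> n0" for n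
      proof -
        have "\<bar>(\<integral>x. f x * g (Z n x) \<partial>R) - (\<integral>x. s i x * g (Z n x) \<partial>R)\<bar> \<le> (\<integral>x. \<bar>f x - s i x\<bar> \<partial>R)"
          by (intro diff abs_g) measurable
        moreover have "\<bar>(\<integral>x. f x * (\<integral>y. g y \<partial>N x) \<partial>R) - (\<integral>x. s i x * (\<integral>y. g y \<partial>N x) \<partial>R)\<bar> \<le> (\<integral>x. \<bar>f x - s i x\<bar> \<partial>R)"
          by (intro diff abs_k) measurable
        ultimately show ?thesis using n0[OF that] i by linarith
      qed
      then show "\<exists>n0. \<forall>n\<ge>n0. norm ((\<integral>x. f x * g (Z n x) \<partial>R) - (\<integral>x. f x * (\<integral>y. g y \<partial>N x) \<partial>R)) < r"
        by auto
    qed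
  qed
qed

text \<open>
  Uniform continuity makes the integrand small where \<open>Z'\<close> and \<open>Z\<close> are close; elsewhere it is at most 1.
\<close>
lemma integral_diff_tendsto_in_prob:
  fixes g :: "real \<Rightarrow> real"
  assumes "prob_space R"
    and Z[measurable]: "\<And>n. Z n \<in> borel_measurable R" and Z'[measurable]: "\<And>n. Z' n \<in> borel_measurable R"
    and close: "\<And>\<epsilon>. 0 < \<epsilon> \<Longrightarrow> (\<lambda>n. measure R {x\<in>space R. \<epsilon> < \<bar>Z' n x - Z n x\<bar>}) \<longlonglongrightarrow> 0"
    and g: "uniformly_continuous_on UNIV g" "\<And>y. 0 \<le> g y" "\<And>y. g y \<le> 1"
  shows "(\<lambda>n. \<integral>x. \<bar>g (Z' n x) - g (Z n x)\<bar> \<partial>R) \<longlonglongrightarrow> 0"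
proof (rule LIMSEQ_I)
  interpret prob_space R by fact
  have [measurable]: "g \<in> borel_measurable borel"
    using g(1) by (intro borel_measurable_continuous_onI uniformly_continuous_imp_continuous)
  fix r :: real assume r: "0 < r"
  have "0 < r / 2" using r by simp
  then obtain d where d: "0 < d" "\<And>y z. \<bar>y - z\<bar> < d \<Longrightarrow> \<bar>g y - g z\<bar> < r / 2"
    using g(1) unfolding uniformly_continuous_on_def dist_real_def by (metis UNIV_I)
  let ?B = "\<lambda>n. {x\<in>space R. d / 2 < \<bar>Z' n x - Z n x\<bar>}"
  obtain n0 where n0: "\<And>n. n \<ge> n0 \<Longrightarrow> prob (?B n) < r / 2"
    using order_tendstoD(2)[OF close[of "d / 2"], of "r / 2"] r d by (auto simp: eventually_sequentially)
  have "(\<integral>x. \<bar>g (Z' n x) - g (Z n x)\<bar> \<partial>R) < r" if n: "n \<ge> n0" for n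
  proof -
    have bnd: "\<bar>g y - g z\<bar> \<le> 1" for y z using g(2,3)[of y] g(2,3)[of z] by auto
    have "(\<integral>x. \<bar>g (Z' n x) - g (Z n x)\<bar> \<partial>R) \<le> (\<integral>x. r / 2 + indicator (?B n) x \<partial>R)"
    proof (rule integral_mono)
      fix x assume x: "x \<in> space R"
      show "\<bar>g (Z' n x) - g (Z n x)\<bar> \<le> r / 2 + indicator (?B n) x"
      proof (cases "x \<in> ?B n")
        case True
        then show ?thesis using bnd[of "Z' n x" "Z n x"] r by simp
      next
        case False
        then have "\<bar>Z' n x - Z n x\<bar> < d" using d x by auto
        then show ?thesis using d(2)[of "Z' n x" "Z n x"] False by simp
      qed
    qed (auto intro!: integrable_const_bound[of _ 1] Bochner_Integration.integrable_add simp: bnd split: split_indicator)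
    also have "\<dots> = r / 2 + prob (?B n)"
      by (subst Bochner_Integration.integral_add)
         (auto intro!: integrable_const_bound[of _ 1] simp: prob_space split: split_indicator)
    also have "\<dots> < r" using n0[OF n] by simp
    finally show ?thesis .
  qed
  then show "\<exists>n0. \<forall>n\<ge>n0. norm ((\<integral>x. \<bar>g (Z' n x) - g (Z n x)\<bar> \<partial>R) - 0) < r"
    by (auto simp: integral_nonneg_AE)
qed

text \<open>
  A version of Slutsky's theorem that also passes from \<open>Q\<close> to \<open>P\<close>: the weight \<open>f 1\<^sub>H\<close> turns an integral
  under \<open>Q\<close> into one over \<open>H\<close> under \<open>P\<close>. Continuous step functions suffice as test functions, and
  they are uniformly continuous, which the perturbation of \<open>Z\<close> requires.
\<close>
theorem stably_converges_change_of_measure: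
  assumes Q: "prob_space Q" and P: "prob_space P" and f[measurable]: "f \<in> borel_measurable Q"
    and f0: "\<And>x. 0 \<le> f x" and Pf: "P = density Q (\<lambda>x. ennreal (f x))"
    and N: "N \<in> Q \<rightarrow>\<^sub>M prob_algebra borel"
    and stable: "stably_converges Q Z N"
    and Z[measurable]: "\<And>n. Z n \<in> borel_measurable Q" and Z'[measurable]: "\<And>n. Z' n \<in> borel_measurable Q"
    and close: "\<And>\<epsilon>. 0 < \<epsilon> \<Longrightarrow> (\<lambda>n. measure P {x\<in>space P. \<epsilon> < \<bar>Z' n x - Z n x\<bar>}) \<longlonglongrightarrow> 0"
  shows "stably_converges P Z' N"
  unfolding stably_converges_def
proof (intro conjI allI ballI impI)
  interpret Q: prob_space Q by fact
  interpret P: prob_space P by fact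
  have sets[measurable_cong]: "sets P = sets Q" by (simp add: Pf)
  have NP: "N \<in> P \<rightarrow>\<^sub>M prob_algebra borel" using N measurable_cong_sets[OF sets refl] by blast
  show "Z' n \<in> borel_measurable P" for n by measurable
  have ZP: "\<And>n. Z n \<in> borel_measurable P" and ZP': "\<And>n. Z' n \<in> borel_measurable P" by measurable
  fix H assume H[measurable]: "H \<in> sets P" and pos: "0 < measure P H"
  have f_int: "integrable Q f"
  proof -
    have "integrable P (\<lambda>_. 1::real)" by simp
    then show ?thesis using f0 unfolding Pf by (subst (asm) integrable_density) auto
  qed
  have PQ: "(\<integral>x. h x \<partial>P) = (\<integral>x. f x * h x \<partial>Q)" if "h \<in> borel_measurable Q" for h :: "_ \<Rightarrow> real"
    using f0 that unfolding Pf by (subst integral_density) auto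
  show "weak_conv_m (\<lambda>n. distr (uniform_measure P H) borel (Z' n)) (uniform_measure P H \<bind> N)"
  proof (rule integral_cts_step_conv_imp_weak_conv)
    \<comment> \<open>any test function will do to see that the two laws are distributions\<close>
    have c0: "0 \<le> cts_step 0 1 y" "cts_step 0 1 y \<le> 1" for y by (auto simp: cts_step_def)
    have cm: "cts_step 0 1 \<in> borel_measurable borel"
      by (intro borel_measurable_continuous_onI uniformly_continuous_imp_continuous cts_step_uniformly_continuous) simp
    show "real_distribution (distr (uniform_measure P H) borel (Z' n))" for n
      by (rule uniform_measure_integrals(3)[OF P H pos ZP' NP cm c0])
    show "real_distribution (uniform_measure P H \<bind> N)"
      by (rule uniform_measure_integrals(4)[OF P H pos ZP' NP cm c0])
    fix a b :: real assume ab: "a < b"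
    let ?g = "cts_step a b"
    have g01: "0 \<le> ?g y" "?g y \<le> 1" for y using ab by (auto simp: cts_step_def field_simps)
    have gu: "uniformly_continuous_on UNIV ?g" by (rule cts_step_uniformly_continuous[OF ab])
    then have gc: "isCont ?g y" for y
      using uniformly_continuous_imp_continuous continuous_on_eq_continuous_at open_UNIV by blast
    have gm[measurable]: "?g \<in> borel_measurable borel"
      by (intro borel_measurable_continuous_onI uniformly_continuous_imp_continuous gu)
    note u = uniform_measure_integrals[OF P H pos _ NP gm g01]
    have [measurable]: "H \<in> sets Q" using H sets by simp
    note [measurable] = kernel_integral(1)[OF N gm g01]
    have "(\<lambda>n. \<integral>x. (f x * indicator H x) * ?g (Z n x) \<partial>Q) \<longlonglongrightarrow> (\<integral>x. (f x * indicator H x) * (\<integral>y. ?g y \<partial>N x) \<partial>Q)"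
      by (intro stably_converges_weighted Q stable Z N gc g01 integrable_real_mult_indicator f_int) measurable
    then have lim: "(\<lambda>n. \<integral>x. indicator H x * ?g (Z n x) \<partial>P) \<longlonglongrightarrow> (\<integral>x. indicator H x * (\<integral>y. ?g y \<partial>N x) \<partial>P)"
      by (simp add: PQ mult.assoc)
    have bd: "integrable P (\<lambda>x. indicator H x * ?g (X x))" "integrable P (\<lambda>x. ?g (X x))"
      if [measurable]: "X \<in> borel_measurable P" for X
      using g01 by (auto intro!: P.integrable_const_bound[of _ 1] split: split_indicator)
    have "(\<lambda>n. (\<integral>x. indicator H x * ?g (Z' n x) \<partial>P) - (\<integral>x. indicator H x * ?g (Z n x) \<partial>P)) \<longlonglongrightarrow> 0"
    proof (rule Lim_null_comparison)
      show "(\<lambda>n. \<integral>x. \<bar>?g (Z' n x) - ?g (Z n x)\<bar> \<partial>P) \<longlonglongrightarrow> 0"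
        by (rule integral_diff_tendsto_in_prob[OF P ZP ZP' close gu g01])
      have "norm ((\<integral>x. indicator H x * ?g (Z' n x) \<partial>P) - (\<integral>x. indicator H x * ?g (Z n x) \<partial>P))
          \<le> (\<integral>x. \<bar>?g (Z' n x) - ?g (Z n x)\<bar> \<partial>P)" for n
      proof -
        have "norm ((\<integral>x. indicator H x * ?g (Z' n x) \<partial>P) - (\<integral>x. indicator H x * ?g (Z n x) \<partial>P))
            = \<bar>\<integral>x. indicator H x * ?g (Z' n x) - indicator H x * ?g (Z n x) \<partial>P\<bar>"
          using bd[OF ZP] bd[OF ZP'] by simp
        also have "\<dots> \<le> (\<integral>x. \<bar>indicator H x * ?g (Z' n x) - indicator H x * ?g (Z n x)\<bar> \<partial>P)"
          by (rule integral_abs_bound)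
        also have "\<dots> \<le> (\<integral>x. \<bar>?g (Z' n x) - ?g (Z n x)\<bar> \<partial>P)"
          by (rule integral_mono) (auto intro!: Bochner_Integration.integrable_diff integrable_abs bd[OF ZP] bd[OF ZP'] split: split_indicator)
        finally show ?thesis .
      qed
      then show "\<forall>\<^sub>F n in sequentially. norm ((\<integral>x. indicator H x * ?g (Z' n x) \<partial>P) - (\<integral>x. indicator H x * ?g (Z n x) \<partial>P))
          \<le> (\<integral>x. \<bar>?g (Z' n x) - ?g (Z n x)\<bar> \<partial>P)" by simp
    qed
    from tendsto_add[OF this lim]
    have "(\<lambda>n. \<integral>x. indicator H x * ?g (Z' n x) \<partial>P) \<longlonglongrightarrow> (\<integral>x. indicator H x * (\<integral>y. ?g y \<partial>N x) \<partial>P)" by simp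
    then show "(\<lambda>n. integral\<^sup>L (distr (uniform_measure P H) borel (Z' n)) ?g) \<longlonglongrightarrow> integral\<^sup>L (uniform_measure P H \<bind> N) ?g"
      unfolding u(1)[OF ZP'] u(2)[OF ZP'] by (rule tendsto_divide[OF _ tendsto_const]) (use pos in simp)
  qed
qed

section \<open>The supremum norm and the history filtration\<close>
lemma countable_sup_norm_measurable:
  assumes "countable D" and "\<And>B. B \<in> D \<Longrightarrow> (\<lambda>\<omega>. G B \<omega>) \<in> borel_measurable M"
  shows "(\<lambda>\<omega>. sup_norm D (\<lambda>B. G B \<omega>)) \<in> borel_measurable M"
proof -
  have [measurable]: "(\<lambda>\<omega>. SUP B\<in>D. ennreal \<bar>G B \<omega>\<bar>) \<in> borel_measurable M"
    using assms by (intro borel_measurable_SUP) auto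
  show ?thesis unfolding sup_norm_def by measurable
qed

lemma sup_norm_nonneg: "0 \<le> sup_norm D G"
  by (simp add: sup_norm_def)

lemma sup_norm_le:
  assumes "\<And>B. B \<in> D \<Longrightarrow> \<bar>G B\<bar> \<le> c" "0 \<le> c"
  shows "sup_norm D G \<le> c"
  unfolding sup_norm_def using assms
  by (intro enn2real_leI SUP_least) (auto intro: ennreal_leI)

text \<open>
  A common bound is essential: an unbounded family has norm 0 by the convention for \<open>\<infinity>\<close>.
\<close>
lemma abs_le_sup_norm:
  assumes bd: "\<And>B. B \<in> D \<Longrightarrow> \<bar>G B\<bar> \<le> c" and B: "B \<in> D"
  shows "\<bar>G B\<bar> \<le> sup_norm D G"
proof -
  have "(SUP B\<in>D. ennreal \<bar>G B\<bar>) \<le> ennreal c"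
    using bd by (intro SUP_least) (auto intro: ennreal_leI)
  then have "(SUP B\<in>D. ennreal \<bar>G B\<bar>) < top" using ennreal_less_top by (rule le_less_trans)
  then have "enn2real (ennreal \<bar>G B\<bar>) \<le> sup_norm D G"
    unfolding sup_norm_def by (intro enn2real_mono SUP_upper B)
  then show ?thesis by simp
qed

lemma sup_norm_diff_le:
  assumes G: "\<And>B. B \<in> D \<Longrightarrow> \<bar>G B\<bar> \<le> c" and H: "\<And>B. B \<in> D \<Longrightarrow> \<bar>H B\<bar> \<le> c"
  shows "\<bar>sup_norm D G - sup_norm D H\<bar> \<le> sup_norm D (\<lambda>B. G B - H B)"
proof -
  have d: "\<bar>G B - H B\<bar> \<le> 2 * c" "\<bar>H B - G B\<bar> \<le> 2 * c" if "B \<in> D" for B using G[OF that] H[OF that] by auto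
  have le: "\<bar>G B - H B\<bar> \<le> sup_norm D (\<lambda>B. G B - H B)" if "B \<in> D" for B
    by (rule abs_le_sup_norm[OF d(1) that])
  have "sup_norm D G \<le> sup_norm D H + sup_norm D (\<lambda>B. G B - H B)"
  proof (rule sup_norm_le)
    fix B assume "B \<in> D"
    then show "\<bar>G B\<bar> \<le> sup_norm D H + sup_norm D (\<lambda>B. G B - H B)"
      using le abs_le_sup_norm[of D H c B, OF H] by fastforce
  qed (simp add: sup_norm_nonneg)
  moreover have "sup_norm D H \<le> sup_norm D G + sup_norm D (\<lambda>B. G B - H B)"
  proof (rule sup_norm_le)
    fix B assume "B \<in> D"
    then show "\<bar>H B\<bar> \<le> sup_norm D G + sup_norm D (\<lambda>B. G B - H B)"
      using le abs_le_sup_norm[of D G c B, OF G] by fastforce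
  qed (simp add: sup_norm_nonneg)
  ultimately show ?thesis by linarith
qed

lemma sup_norm_cmult:
  assumes "0 \<le> c"
  shows "sup_norm D (\<lambda>B. c * G B) = c * sup_norm D G"
proof -
  have "(SUP B\<in>D. ennreal \<bar>c * G B\<bar>) = ennreal c * (SUP B\<in>D. ennreal \<bar>G B\<bar>)"
    using assms by (simp add: SUP_mult_left_ennreal abs_mult ennreal_mult)
  then show ?thesis using assms by (simp add: sup_norm_def enn2real_mult)
qed

lemma measurable_seq_space:
  "sets P = sets (seq_space S) \<Longrightarrow> f \<in> borel_measurable (seq_space S) \<Longrightarrow> f \<in> borel_measurable P"
  by (simp cong: measurable_cong_sets)

lemma space_hist: "space (hist S n) = space (seq_space S)"
  unfolding hist_def by (rule space_measure_of) auto

lemma sets_hist: "sets (hist S n) = sigma_sets (space (seq_space S))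
     {(\<lambda>\<omega>. \<omega> i) -` B \<inter> space (seq_space S) |i B. i \<in> {1..n} \<and> B \<in> sets S}"
  unfolding hist_def by (rule sets_measure_of) auto

lemma coordinate_measurable: "1 \<le> i \<Longrightarrow> (\<lambda>\<omega>. \<omega> i) \<in> seq_space S \<rightarrow>\<^sub>M S"
  unfolding seq_space_def by (rule measurable_component_singleton) simp

lemma sets_hist_subset: "sets (hist S n) \<subseteq> sets (seq_space S)"
  unfolding sets_hist by (rule sets.sigma_sets_subset) (auto intro: measurable_sets[OF coordinate_measurable])

lemma sets_hist_mono: "m \<le> n \<Longrightarrow> sets (hist S m) \<subseteq> sets (hist S n)"
  unfolding sets_hist by (intro sigma_sets_mono' Collect_mono) fastforce

lemma coordinate_hist_measurable:
  assumes "i \<in> {1..n}"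
  shows "(\<lambda>\<omega>. \<omega> i) \<in> hist S n \<rightarrow>\<^sub>M S"
proof (rule measurableI)
  show "\<omega> i \<in> space S" if "\<omega> \<in> space (hist S n)" for \<omega>
    using that measurable_space[OF coordinate_measurable, of i \<omega> S] assms by (auto simp: space_hist)
  show "(\<lambda>\<omega>. \<omega> i) -` B \<inter> space (hist S n) \<in> sets (hist S n)" if "B \<in> sets S" for B
    using that assms unfolding space_hist sets_hist by (intro sigma_sets.Basic) auto
qed

lemma indicator_hist_measurable:
  "i \<in> {1..n} \<Longrightarrow> B \<in> sets S \<Longrightarrow> (\<lambda>\<omega>. indicator B (\<omega> i) :: real) \<in> borel_measurable (hist S n)"
  by (rule measurable_compose[OF coordinate_hist_measurable borel_measurable_indicator])

text \<open>
  The histories exhaust the product sigma-algebra, so Levy's theorem applies to every integrable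
  function on the sequence space, the density \<open>dP/dQ\<close> in particular.
\<close>
lemma sets_seq_space_generated:
  "sets (seq_space S) = sigma_sets (space (seq_space S)) (\<Union>n. sets (hist S n))"
proof
  show "sets (seq_space S) \<subseteq> sigma_sets (space (seq_space S)) (\<Union>n. sets (hist S n))"
  proof -
    have "sets (seq_space S) = sigma_sets (space (seq_space S))
        {{f \<in> space (seq_space S). f i \<in> A} |i A. i \<in> {1..} \<and> A \<in> sets S}"
      by (simp add: seq_space_def sets_PiM_single space_PiM)
    moreover have "{{f \<in> space (seq_space S). f i \<in> A} |i A. i \<in> {1..} \<and> A \<in> sets S}
        \<subseteq> (\<Union>n. sets (hist S n))"
    proof safe
      fix i :: nat and A assume i: "1 \<le> i" and A: "A \<in> sets S"
      have "(\<lambda>\<omega>. \<omega> i) -` A \<inter> space (hist S i) \<in> sets (hist S i)"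
        using i A by (intro measurable_sets[OF coordinate_hist_measurable]) auto
      moreover have "(\<lambda>\<omega>. \<omega> i) -` A \<inter> space (hist S i) = {f \<in> space (seq_space S). f i \<in> A}"
        by (auto simp: space_hist)
      ultimately show "{f \<in> space (seq_space S). f i \<in> A} \<in> (\<Union>n. sets (hist S n))" by auto
    qed
    ultimately show ?thesis by (simp add: sigma_sets_mono')
  qed
  show "sigma_sets (space (seq_space S)) (\<Union>n. sets (hist S n)) \<subseteq> sets (seq_space S)"
    using sets_hist_subset by (intro sets.sigma_sets_subset) auto
qed

lemma filtered_prob_space_hist:
  assumes "prob_space P" "sets P = sets (seq_space S)"
  shows "filtered_prob_space P (hist S)"
proof -
  interpret prob_space P by fact
  show ?thesis
  proof
    show "subalgebra P (hist S n)" for n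
      using sets_hist_subset[of S n] sets_eq_imp_space_eq[OF assms(2)] assms(2)
      by (simp add: subalgebra_def space_hist)
    show "m \<le> n \<Longrightarrow> sets (hist S m) \<subseteq> sets (hist S n)" for m n by (rule sets_hist_mono)
  qed
qed

lemma emp_hist_measurable: "B \<in> sets S \<Longrightarrow> emp n B \<in> borel_measurable (hist S n)"
  unfolding emp_def[abs_def]
  by (intro borel_measurable_divide borel_measurable_sum indicator_hist_measurable) auto

lemma emp_measurable: "B \<in> sets S \<Longrightarrow> emp n B \<in> borel_measurable (seq_space S)"
  using emp_hist_measurable[of B S n] sets_hist_subset[of S n] by (auto simp: measurable_def space_hist)

lemma emp_bounds: "0 \<le> emp n B \<omega>" "emp n B \<omega> \<le> 1"
proof -
  show "0 \<le> emp n B \<omega>" by (simp add: emp_def sum_nonneg)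
  have "(\<Sum>i=1..n. indicator B (\<omega> i) :: real) \<le> (\<Sum>i=1..n. 1)"
    by (intro sum_mono) (auto split: split_indicator)
  then show "emp n B \<omega> \<le> 1" by (cases "n = 0") (auto simp: emp_def)
qed

lemma emp_lim_measurable:
  assumes "B \<in> sets S"
  shows "emp_lim B \<in> borel_measurable (seq_space S)"
proof -
  have "(\<lambda>\<omega>. ereal (emp n B \<omega>)) \<in> borel_measurable (seq_space S)" for n
    by (rule borel_measurable_ereal[OF emp_measurable[OF assms]])
  then show ?thesis
    unfolding emp_lim_def[abs_def] by (rule borel_measurable_real_of_ereal[OF borel_measurable_limsup])
qed

lemma emp_lim_bounds: "0 \<le> emp_lim B \<omega>" "emp_lim B \<omega> \<le> 1"
proof -
  let ?l = "limsup (\<lambda>n. ereal (emp n B \<omega>))"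
  have u: "?l \<le> 1" by (intro Limsup_bounded) (auto simp: emp_bounds)
  have l: "0 \<le> ?l"
    by (intro order_trans[OF _ Liminf_le_Limsup] Liminf_bounded) (auto simp: emp_bounds)
  show "0 \<le> emp_lim B \<omega>" unfolding emp_lim_def using l by (rule real_of_ereal_pos)
  show "emp_lim B \<omega> \<le> 1" unfolding emp_lim_def using u l by (cases ?l) auto
qed

lemma W_measurable:
  assumes "B \<in> sets S"
  shows "W n B \<in> borel_measurable (seq_space S)"
  unfolding W_def[abs_def]
  by (intro borel_measurable_times borel_measurable_const borel_measurable_diff
      emp_measurable[OF assms] emp_lim_measurable[OF assms])

lemma W_bound: "\<bar>W n B \<omega>\<bar> \<le> sqrt (real n)"
proof -
  have "\<bar>emp n B \<omega> - emp_lim B \<omega>\<bar> \<le> 1"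
    using emp_bounds[of n B \<omega>] emp_lim_bounds[of B \<omega>] by auto
  then show ?thesis by (simp add: W_def abs_mult mult_left_le)
qed

lemma C_hist_measurable: "C S R n B \<in> borel_measurable (hist S n)"
  unfolding C_def by (rule borel_measurable_cond_exp)

text \<open>
  The conditional expectations are versions, so the bound \<open>\<surd>n\<close> of \<open>W\<^sub>n\<close> passes to them only up to a null set.
\<close>
lemma C_bound:
  assumes "prob_space R" "sets R = sets (seq_space S)" "B \<in> sets S"
  shows "AE \<omega> in R. \<bar>C S R n B \<omega>\<bar> \<le> sqrt (real n)"
proof -
  interpret filtered_prob_space R "hist S" by (rule filtered_prob_space_hist[OF assms(1,2)])
  interpret sigma_finite_subalgebra R "hist S n" by (rule sigma_finite_subalgebra_F)
  have W: "W n B \<in> borel_measurable R" by (rule measurable_seq_space[OF assms(2) W_measurable[OF assms(3)]])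
  have "AE \<omega> in R. \<bar>real_cond_exp R (hist S n) (W n B) \<omega>\<bar> \<le> real_cond_exp R (hist S n) (\<lambda>_. sqrt (real n)) \<omega>"
    by (intro real_cond_exp_abs_le integrable_const_bound[of _ "sqrt (real n)"]) (auto simp: W_bound W)
  moreover have "AE \<omega> in R. real_cond_exp R (hist S n) (\<lambda>_. sqrt (real n)) \<omega> = sqrt (real n)"
    by (intro real_cond_exp_F_meas) auto
  ultimately show ?thesis unfolding C_def by eventually_elim auto
qed

section \<open>Predictive distributions of a c.i.d. sequence\<close>
lemma Cesaro_mean_tendsto:
  fixes x :: "nat \<Rightarrow> real"
  assumes "x \<longlonglongrightarrow> L"
  shows "(\<lambda>n. (\<Sum>i<n. x i) / real n) \<longlonglongrightarrow> L"
proof (rule LIMSEQ_I)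
  fix r :: real assume r: "0 < r"
  obtain N where N: "\<And>n. n \<ge> N \<Longrightarrow> \<bar>x n - L\<bar> < r / 2"
    using LIMSEQ_D[OF assms, of "r / 2"] r by auto
  define S where "S = (\<Sum>i<N. \<bar>x i - L\<bar>)"
  obtain n0 where n0: "2 * S / r < real n0" using reals_Archimedean2 by blast
  have "\<bar>(\<Sum>i<n. x i) / real n - L\<bar> < r" if n: "n \<ge> max (Suc N) n0" for n
  proof -
    have n': "0 < real n" "N \<le> n" "2 * S / r < real n" using n n0 by auto
    have "\<bar>(\<Sum>i<n. x i) - real n * L\<bar> = \<bar>\<Sum>i<n. x i - L\<bar>"
      by (simp add: sum_subtractf)
    also have "\<dots> \<le> (\<Sum>i<n. \<bar>x i - L\<bar>)" by (rule sum_abs)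
    also have "\<dots> = S + (\<Sum>i\<in>{N..<n}. \<bar>x i - L\<bar>)"
      unfolding S_def using n'(2) by (metis lessThan_atLeast0 sum.atLeastLessThan_concat zero_le)
    also have "(\<Sum>i\<in>{N..<n}. \<bar>x i - L\<bar>) \<le> (\<Sum>i\<in>{N..<n}. r / 2)"
      using N by (intro sum_mono) (auto intro: less_imp_le)
    also have "\<dots> \<le> real n * (r / 2)" using r by simp
    also have "S + real n * (r / 2) < real n * r"
      using n'(3) r by (simp add: field_simps)
    finally have "\<bar>(\<Sum>i<n. x i) - real n * L\<bar> < real n * r" by simp
    moreover have "(\<Sum>i<n. x i) / real n - L = ((\<Sum>i<n. x i) - real n * L) / real n"
      using n'(1) by (simp add: field_simps)
    ultimately show ?thesis using n'(1) by (simp add: abs_divide pos_divide_less_eq mult.commute)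
  qed
  then show "\<exists>no. \<forall>n\<ge>no. norm ((\<Sum>i<n. x i) / real n - L) < r"
    unfolding real_norm_def by blast
qed

text \<open>
  Summation by parts writes the average of the \<open>d i\<close> as the difference between the partial sum
  \<open>s n\<close> and the Cesaro mean of the earlier partial sums; both have the same limit.
\<close>
lemma Kronecker_lemma:
  fixes d :: "nat \<Rightarrow> real"
  assumes "convergent (\<lambda>n. \<Sum>i=1..n. d i / real i)"
  shows "(\<lambda>n. (\<Sum>i=1..n. d i) / real n) \<longlonglongrightarrow> 0"
proof -
  define s where "s n = (\<Sum>i=1..n. d i / real i)" for n
  obtain L where L: "s \<longlonglongrightarrow> L" using assms unfolding convergent_def s_def by auto
  have Abel: "(\<Sum>i=1..n. d i) = real n * s n - (\<Sum>i<n. s i)" for n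
  proof (induction n)
    case (Suc n)
    have "s (Suc n) = s n + d (Suc n) / real (Suc n)" by (simp add: s_def)
    then have "real (Suc n) * s (Suc n) = real (Suc n) * s n + d (Suc n)" by (simp add: distrib_left)
    then show ?case using Suc by (simp add: algebra_simps)
  qed (simp add: s_def)
  have "(\<lambda>n. s n - (\<Sum>i<n. s i) / real n) \<longlonglongrightarrow> L - L"
    by (intro tendsto_diff L Cesaro_mean_tendsto)
  then have "(\<lambda>n. s n - (\<Sum>i<n. s i) / real n) \<longlonglongrightarrow> 0" by simp
  moreover have "\<forall>\<^sub>F n in sequentially. s n - (\<Sum>i<n. s i) / real n = (\<Sum>i=1..n. d i) / real n"
    using eventually_gt_at_top[of 0] by eventually_elim (unfold Abel, simp add: diff_divide_distrib)
  ultimately show ?thesis by (rule Lim_transform_eventually)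
qed

context
  fixes S :: "'a measure" and P :: "(nat \<Rightarrow> 'a) measure" and B :: "'a set"
  assumes P: "prob_space P" "sets P = sets (seq_space S)" and cid: "cid S P" and B: "B \<in> sets S"
begin

interpretation filtered_prob_space P "hist S" by (rule filtered_prob_space_hist[OF P])

lemma coordinate_indicator_measurable:
  assumes "1 \<le> i"
  shows "(\<lambda>\<omega>. indicator B (\<omega> i) :: real) \<in> borel_measurable P"
proof (rule measurable_F)
  show "(\<lambda>\<omega>. indicator B (\<omega> i) :: real) \<in> borel_measurable (hist S i)"
    using assms by (intro indicator_hist_measurable B) simp
qed

lemma coordinate_indicator_integrable:
  assumes "1 \<le> i"
  shows "integrable P (\<lambda>\<omega>. indicator B (\<omega> i) :: real)"
proof (rule integrable_const_bound[of _ 1])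
  show "AE \<omega> in P. norm (indicator B (\<omega> i) :: real) \<le> 1"
    by (rule AE_I2) (simp split: split_indicator)
qed (rule coordinate_indicator_measurable[OF assms])

lemma pred_adapted: "pred S P n B \<in> borel_measurable (hist S n)"
  unfolding pred_def by (rule borel_measurable_cond_exp)

lemma pred_bounds: "AE \<omega> in P. 0 \<le> pred S P n B \<omega> \<and> pred S P n B \<omega> \<le> 1"
proof -
  interpret sigma_finite_subalgebra P "hist S n" by (rule sigma_finite_subalgebra_F)
  have "AE \<omega> in P. 0 \<le> pred S P n B \<omega>"
    unfolding pred_def by (rule real_cond_exp_pos[OF AE_I2 coordinate_indicator_measurable]) simp_all
  moreover have "AE \<omega> in P. pred S P n B \<omega> \<le> real_cond_exp P (hist S n) (\<lambda>_. 1) \<omega>"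
    unfolding pred_def by (intro real_cond_exp_mono coordinate_indicator_integrable) (auto split: split_indicator)
  moreover have "AE \<omega> in P. real_cond_exp P (hist S n) (\<lambda>_. 1) \<omega> = 1"
    by (intro real_cond_exp_F_meas) auto
  ultimately show ?thesis by eventually_elim auto
qed

lemma pred_abs_le: "AE \<omega> in P. \<bar>pred S P n B \<omega>\<bar> \<le> 1"
  using pred_bounds[of n] by eventually_elim auto

lemma pred_integrable: "integrable P (pred S P n B)"
  unfolding pred_def by (intro integrable_cond_exp_F coordinate_indicator_integrable) simp

lemma pred_measurable: "pred S P n B \<in> borel_measurable P"
  by (rule borel_measurable_integrable[OF pred_integrable])

text \<open>
  Conditioning the prediction of \<open>X\<^sub>n\<^sub>+\<^sub>2\<close> on \<open>G\<^sub>n\<close> gives \<open>P(X\<^sub>n\<^sub>+\<^sub>2 \<in> B | G\<^sub>n)\<close>, which the c.i.d. property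
  identifies with \<open>P(X\<^sub>n\<^sub>+\<^sub>1 \<in> B | G\<^sub>n)\<close>.
\<close>
lemma pred_martingale: "AE \<omega> in P. real_cond_exp P (hist S n) (pred S P (Suc n) B) \<omega> = pred S P n B \<omega>"
proof -
  interpret sigma_finite_subalgebra P "hist S n" by (rule sigma_finite_subalgebra_F)
  have "subalgebra (hist S (Suc n)) (hist S n)"
    using sets_hist_mono[of n "Suc n" S] by (simp add: subalgebra_def space_hist)
  then have "AE \<omega> in P. real_cond_exp P (hist S n) (pred S P (Suc n) B) \<omega> =
      real_cond_exp P (hist S n) (\<lambda>\<omega>. indicator B (\<omega> (Suc n + 1))) \<omega>"
    unfolding pred_def by (intro real_cond_exp_nested_subalg subalgebra_F coordinate_indicator_integrable) auto
  moreover have "AE \<omega> in P. real_cond_exp P (hist S n) (\<lambda>\<omega>. indicator B (\<omega> (Suc n + 1))) \<omega>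
      = real_cond_exp P (hist S n) (\<lambda>\<omega>. indicator B (\<omega> (n + 1))) \<omega>"
    using cid B unfolding cid_def by simp
  ultimately show ?thesis unfolding pred_def by eventually_elim simp
qed

lemma pred_convergent: "AE \<omega> in P. convergent (\<lambda>n. pred S P n B \<omega>)"
proof (rule L2_bounded_martingale_convergent[OF pred_adapted pred_abs_le pred_martingale])
  fix n
  have "(\<integral>\<omega>. (pred S P n B \<omega>)\<^sup>2 \<partial>P) \<le> (\<integral>\<omega>. 1 \<partial>P)"
  proof (rule integral_mono_AE)
    have le: "AE \<omega> in P. (pred S P n B \<omega>)\<^sup>2 \<le> 1"
      using pred_bounds[of n] by eventually_elim (simp add: power_le_one)
    then show "AE \<omega> in P. (pred S P n B \<omega>)\<^sup>2 \<le> 1" .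
    have "AE \<omega> in P. norm ((pred S P n B \<omega>)\<^sup>2) \<le> 1"
      using le by eventually_elim simp
    then show "integrable P (\<lambda>\<omega>. (pred S P n B \<omega>)\<^sup>2)"
      by (rule integrable_const_bound) (rule borel_measurable_power[OF pred_measurable])
  qed simp
  then show "(\<integral>\<omega>. (pred S P n B \<omega>)\<^sup>2 \<partial>P) \<le> 1" by (simp add: prob_space)
qed

text \<open>
  The innovations are martingale differences bounded by 1. Divided by their index they sum to a
  martingale with second moments at most \<open>\<Sum> 1/i\<^sup>2\<close>, which converges; Kronecker's lemma does the rest.
\<close>
lemma innovations_average_tendsto_0:
  "AE \<omega> in P. (\<lambda>n. (\<Sum>i=1..n. indicator B (\<omega> i) - pred S P (i - 1) B \<omega>) / real n) \<longlonglongrightarrow> 0"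
proof -
  define d where "d i \<omega> = indicator B (\<omega> i) - pred S P (i - 1) B \<omega>" for i \<omega>
  define X where "X n \<omega> = (\<Sum>i=1..n. d i \<omega> / real i)" for n \<omega>
  have d_meas: "d i \<in> borel_measurable (hist S n)" if "i \<in> {1..n}" for i n
    unfolding d_def[abs_def] using that B
    by (intro borel_measurable_diff indicator_hist_measurable measurable_F_mono[OF _ pred_adapted]) auto
  have d_bound: "AE \<omega> in P. \<bar>d i \<omega>\<bar> \<le> 1" for i
    using pred_bounds[of "i - 1"] unfolding d_def by eventually_elim (auto split: split_indicator)
  have d_int: "1 \<le> i \<Longrightarrow> integrable P (d i)" for i
    unfolding d_def[abs_def] by (intro Bochner_Integration.integrable_diff coordinate_indicator_integrable pred_integrable)
  have X_adapted: "X n \<in> borel_measurable (hist S n)" for n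
    unfolding X_def[abs_def] by (intro borel_measurable_sum borel_measurable_divide d_meas) auto
  have X_int: "integrable P (X n)" for n
    unfolding X_def[abs_def] by (intro Bochner_Integration.integrable_sum integrable_divide d_int) auto
  have X_bound: "AE \<omega> in P. \<bar>X n \<omega>\<bar> \<le> real n" for n
  proof -
    have "AE \<omega> in P. \<forall>i\<in>{1..n}. \<bar>d i \<omega>\<bar> \<le> 1"
      using d_bound by (intro AE_finite_allI) auto
    then show ?thesis
    proof eventually_elim
      case (elim \<omega>)
      have "\<bar>X n \<omega>\<bar> \<le> (\<Sum>i=1..n. \<bar>d i \<omega> / real i\<bar>)" unfolding X_def by (rule sum_abs)
      also have "\<dots> \<le> (\<Sum>i=1..n. 1)"
      proof (rule sum_mono)
        fix i assume "i \<in> {1..n}"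
        then show "\<bar>d i \<omega> / real i\<bar> \<le> 1" using elim by (auto simp: abs_divide divide_le_eq) force
      qed
      finally show ?case by simp
    qed
  qed
  have X_Suc: "X (Suc n) \<omega> = X n \<omega> + d (Suc n) \<omega> / real (Suc n)" for n \<omega>
    by (simp add: X_def)
  have X_mart: "AE \<omega> in P. real_cond_exp P (hist S n) (X (Suc n)) \<omega> = X n \<omega>" for n
  proof -
    interpret sigma_finite_subalgebra P "hist S n" by (rule sigma_finite_subalgebra_F)
    have "AE \<omega> in P. real_cond_exp P (hist S n) (X (Suc n)) \<omega> =
        real_cond_exp P (hist S n) (X n) \<omega> + real_cond_exp P (hist S n) (\<lambda>\<omega>. d (Suc n) \<omega> / real (Suc n)) \<omega>"
      unfolding X_Suc[abs_def] by (intro real_cond_exp_add X_int integrable_divide d_int) simp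
    moreover have "AE \<omega> in P. real_cond_exp P (hist S n) (X n) \<omega> = X n \<omega>"
      by (rule real_cond_exp_F_meas[OF X_int X_adapted])
    moreover have "AE \<omega> in P. real_cond_exp P (hist S n) (\<lambda>\<omega>. d (Suc n) \<omega> / real (Suc n)) \<omega>
        = real_cond_exp P (hist S n) (d (Suc n)) \<omega> / real (Suc n)"
      by (intro real_cond_exp_cdiv d_int) simp
    moreover have "AE \<omega> in P. real_cond_exp P (hist S n) (d (Suc n)) \<omega>
        = pred S P n B \<omega> - real_cond_exp P (hist S n) (pred S P n B) \<omega>"
      using real_cond_exp_diff[OF coordinate_indicator_integrable[of "Suc n"] pred_integrable[of n]]
      by (simp add: d_def[abs_def] pred_def)
    moreover have "AE \<omega> in P. real_cond_exp P (hist S n) (pred S P n B) \<omega> = pred S P n B \<omega>"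
      by (rule real_cond_exp_F_meas[OF pred_integrable pred_adapted])
    ultimately show ?thesis by eventually_elim simp
  qed
  have X_moment: "(\<integral>\<omega>. (X n \<omega>)\<^sup>2 \<partial>P) \<le> (\<Sum>i=1..n. inverse (real i ^ 2))" for n
  proof (induction n)
    case (Suc n)
    have "(\<integral>\<omega>. (X (Suc n) \<omega> - X n \<omega>)\<^sup>2 \<partial>P) \<le> (\<integral>\<omega>. inverse (real (Suc n) ^ 2) \<partial>P)"
    proof (rule integral_mono_AE)
      show le: "AE \<omega> in P. (X (Suc n) \<omega> - X n \<omega>)\<^sup>2 \<le> inverse (real (Suc n) ^ 2)"
        using d_bound[of "Suc n"]
      proof eventually_elim
        case (elim \<omega>)
        then have "(d (Suc n) \<omega>)\<^sup>2 \<le> 1" by (simp add: abs_square_le_1)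
        then have "(d (Suc n) \<omega>)\<^sup>2 * inverse (real (Suc n) ^ 2) \<le> inverse (real (Suc n) ^ 2)"
          by (intro mult_left_le_one_le) auto
        moreover have "(X (Suc n) \<omega> - X n \<omega>)\<^sup>2 = (d (Suc n) \<omega>)\<^sup>2 * inverse (real (Suc n) ^ 2)"
          unfolding X_Suc by (simp only: add_diff_cancel_left' power_divide) (simp only: divide_inverse)
        ultimately show ?case by simp
      qed
      have "AE \<omega> in P. norm ((X (Suc n) \<omega> - X n \<omega>)\<^sup>2) \<le> inverse (real (Suc n) ^ 2)"
        using le by eventually_elim simp
      then show "integrable P (\<lambda>\<omega>. (X (Suc n) \<omega> - X n \<omega>)\<^sup>2)"
        by (rule integrable_const_bound)
           (intro borel_measurable_power borel_measurable_diff borel_measurable_integrable[OF X_int])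
    qed simp
    then show ?case
      using Suc martingale_second_moments[OF X_adapted X_bound X_mart, of n "Suc n"] by (simp add: prob_space)
  qed (simp add: X_def)
  have "AE \<omega> in P. convergent (\<lambda>n. X n \<omega>)"
  proof (rule L2_bounded_martingale_convergent[OF X_adapted X_bound X_mart])
    fix n
    have "(\<Sum>i=1..n. inverse (real i ^ 2)) \<le> (\<Sum>i. inverse (real i ^ 2))"
      by (intro sum_le_suminf inverse_power_summable) auto
    with X_moment[of n] show "(\<integral>\<omega>. (X n \<omega>)\<^sup>2 \<partial>P) \<le> (\<Sum>i. inverse (real i ^ 2))" by (rule order_trans)
  qed
  then show ?thesis
    unfolding X_def d_def by eventually_elim (rule Kronecker_lemma)
qed

text \<open>
  The empirical frequency is the average innovation plus the Cesaro mean of the predictions; the first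
  vanishes and the second has the limit of the predictions.
\<close>
theorem pred_tendsto_emp_lim: "AE \<omega> in P. (\<lambda>n. pred S P n B \<omega>) \<longlonglongrightarrow> emp_lim B \<omega>"
  using pred_convergent innovations_average_tendsto_0
proof eventually_elim
  case (elim \<omega>)
  then obtain L where L: "(\<lambda>n. pred S P n B \<omega>) \<longlonglongrightarrow> L" by (auto simp: convergent_def)
  have emp: "emp n B \<omega> = (\<Sum>i=1..n. indicator B (\<omega> i) - pred S P (i - 1) B \<omega>) / real n
      + (\<Sum>i<n. pred S P i B \<omega>) / real n" for n
  proof -
    have "(\<Sum>i=1..n. pred S P (i - 1) B \<omega>) = (\<Sum>i<n. pred S P i B \<omega>)"
      by (induction n) auto
    then show ?thesis by (simp add: emp_def sum_subtractf diff_divide_distrib)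
  qed
  have "(\<lambda>n. emp n B \<omega>) \<longlonglongrightarrow> 0 + L"
    unfolding emp by (intro tendsto_add elim Cesaro_mean_tendsto L)
  then have "limsup (\<lambda>n. ereal (emp n B \<omega>)) = ereal L"
    by (intro lim_imp_Limsup) auto
  then show ?case using L by (simp add: emp_lim_def)
qed

text \<open>
  For \<open>A\<close> in the history at time \<open>n\<close>, the integral of the \<open>k\<close>-th prediction over \<open>A\<close> is constant in
  \<open>k \<ge> n\<close>. By bounded convergence it equals the integral of the limit.
\<close>
lemma cond_exp_emp_lim: "AE \<omega> in P. real_cond_exp P (hist S n) (emp_lim B) \<omega> = pred S P n B \<omega>"
proof -
  interpret sigma_finite_subalgebra P "hist S n" by (rule sigma_finite_subalgebra_F)
  have el: "emp_lim B \<in> borel_measurable P"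
    by (rule measurable_seq_space[OF P(2) emp_lim_measurable[OF B]])
  show ?thesis
  proof (rule real_cond_exp_charact)
    fix A assume A: "A \<in> sets (hist S n)"
    have [measurable]: "A \<in> sets P" by (rule sets_F_sub[OF A])
    have lim: "(\<lambda>k. \<integral>\<omega>. indicator A \<omega> * pred S P k B \<omega> \<partial>P) \<longlonglongrightarrow> (\<integral>\<omega>. indicator A \<omega> * emp_lim B \<omega> \<partial>P)"
    proof (rule integral_dominated_convergence[where w="\<lambda>_. 1"])
      show "AE \<omega> in P. (\<lambda>k. indicator A \<omega> * pred S P k B \<omega>) \<longlonglongrightarrow> indicator A \<omega> * emp_lim B \<omega>"
        using pred_tendsto_emp_lim by eventually_elim (rule tendsto_mult_left)
      show "AE \<omega> in P. norm (indicator A \<omega> * pred S P k B \<omega>) \<le> 1" for k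
        using pred_abs_le[of k] by eventually_elim (auto split: split_indicator)
      show "(\<lambda>\<omega>. indicator A \<omega> * pred S P k B \<omega>) \<in> borel_measurable P" for k
        by (intro borel_measurable_times borel_measurable_indicator pred_measurable) fact
      show "(\<lambda>\<omega>. indicator A \<omega> * emp_lim B \<omega>) \<in> borel_measurable P"
        by (intro borel_measurable_times borel_measurable_indicator el) fact
    qed simp
    have const: "\<forall>\<^sub>F k in sequentially. (\<integral>\<omega>. indicator A \<omega> * pred S P k B \<omega> \<partial>P) = (\<integral>\<omega>. indicator A \<omega> * pred S P n B \<omega> \<partial>P)"
      using eventually_ge_at_top[of n]
    proof eventually_elim
      case (elim k)
      have "indicator A \<in> borel_measurable (hist S n)" using A by (rule borel_measurable_indicator)
      moreover have "AE \<omega> in P. \<bar>indicator A \<omega> :: real\<bar> \<le> 1" by (rule AE_I2) (simp split: split_indicator)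
      ultimately show ?case
        using elim by (rule martingale_test_function(2)[OF pred_adapted pred_abs_le pred_martingale])
    qed
    have "(\<integral>\<omega>. indicator A \<omega> * emp_lim B \<omega> \<partial>P) = (\<integral>\<omega>. indicator A \<omega> * pred S P n B \<omega> \<partial>P)"
      by (rule LIMSEQ_unique[OF lim tendsto_eventually[OF const]])
    then show "(\<integral>\<omega>\<in>A. emp_lim B \<omega> \<partial>P) = (\<integral>\<omega>\<in>A. pred S P n B \<omega> \<partial>P)"
      by (simp add: set_lebesgue_integral_def)
  next
    show "integrable P (emp_lim B)"
      by (rule integrable_const_bound[of _ 1, OF _ el]) (simp add: emp_lim_bounds)
  qed (rule pred_integrable pred_adapted)+
qed

text \<open>
  The empirical frequency is known at time \<open>n\<close>, and the limit frequency is predicted by \<open>pred\<close>.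
\<close>
theorem C_eq_emp_minus_pred:
  "AE \<omega> in P. C S P n B \<omega> = sqrt (real n) * (emp n B \<omega> - pred S P n B \<omega>)"
proof -
  interpret sigma_finite_subalgebra P "hist S n" by (rule sigma_finite_subalgebra_F)
  have el: "emp_lim B \<in> borel_measurable P"
    by (rule measurable_seq_space[OF P(2) emp_lim_measurable[OF B]])
  have em: "emp n B \<in> borel_measurable (hist S n)" by (rule emp_hist_measurable[OF B])
  have em_P: "emp n B \<in> borel_measurable P" by (rule measurable_F[OF em])
  have int: "integrable P (emp_lim B)" "integrable P (emp n B)"
    by (rule integrable_const_bound[of _ 1, OF _ el], simp add: emp_lim_bounds)
       (rule integrable_const_bound[of _ 1, OF _ em_P], simp add: emp_bounds)
  have "AE \<omega> in P. C S P n B \<omega> = sqrt (real n) * real_cond_exp P (hist S n) (\<lambda>\<omega>. emp n B \<omega> - emp_lim B \<omega>) \<omega>"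
    unfolding C_def W_def[abs_def] by (intro real_cond_exp_cmult Bochner_Integration.integrable_diff int)
  moreover have "AE \<omega> in P. real_cond_exp P (hist S n) (\<lambda>\<omega>. emp n B \<omega> - emp_lim B \<omega>) \<omega>
      = real_cond_exp P (hist S n) (emp n B) \<omega> - real_cond_exp P (hist S n) (emp_lim B) \<omega>"
    by (intro real_cond_exp_diff int)
  moreover have "AE \<omega> in P. real_cond_exp P (hist S n) (emp n B) \<omega> = emp n B \<omega>"
    by (rule real_cond_exp_F_meas[OF int(2) em])
  ultimately show ?thesis using cond_exp_emp_lim[of n] by eventually_elim simp
qed

end

section \<open>Conditional expectations under a change of measure\<close>
lemma uniformly_integrable_tail:
  assumes ui: "uniformly_integrable R V" and int: "\<And>n. integrable R (V n)"
    and V0: "\<And>n x. 0 \<le> V n x" and e: "0 < e"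
  shows "\<exists>c0. \<forall>c\<ge>c0. \<forall>n\<ge>1. (\<integral>x. indicator {x\<in>space R. c < V n x} x * V n x \<partial>R) \<le> e"
proof -
  let ?s = "\<lambda>c n. \<integral>\<^sup>+x\<in>{x\<in>space R. c < \<bar>V n x\<bar>}. ennreal \<bar>V n x\<bar> \<partial>R"
  have "((\<lambda>c. SUP n\<in>{1..}. ?s c n) \<longlongrightarrow> 0) at_top"
    using ui by (simp add: uniformly_integrable_def)
  then have "\<forall>\<^sub>F c in at_top. (SUP n\<in>{1..}. ?s c n) < ennreal e"
    using e by (intro order_tendstoD(2)) auto
  then obtain c0 where c0: "\<And>c. c0 \<le> c \<Longrightarrow> (SUP n\<in>{1..}. ?s c n) < ennreal e"
    by (auto simp: eventually_at_top_linorder)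
  have "(\<integral>x. indicator {x\<in>space R. c < V n x} x * V n x \<partial>R) \<le> e" if "c0 \<le> c" "1 \<le> n" for c n
  proof -
    let ?T = "{x\<in>space R. c < V n x}"
    have "?T \<in> sets R" using borel_measurable_integrable[OF int[of n]] by measurable
    then have iT: "integrable R (\<lambda>x. indicator ?T x * V n x)"
      using integrable_mult_indicator[OF _ int] by simp
    have "ennreal (\<integral>x. indicator ?T x * V n x \<partial>R) = (\<integral>\<^sup>+x. ennreal (indicator ?T x * V n x) \<partial>R)"
      by (rule nn_integral_eq_integral[symmetric, OF iT]) (simp add: V0)
    also have "\<dots> = ?s c n"
      using V0 by (intro nn_integral_cong) (auto split: split_indicator)
    also have "\<dots> \<le> (SUP n\<in>{1..}. ?s c n)" using that(2) by (intro SUP_upper) simp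
    also have "\<dots> < ennreal e" by (rule c0[OF that(1)])
    finally show ?thesis using e by (simp add: ennreal_less_iff integral_nonneg_AE V0)
  qed
  then show ?thesis by blast
qed

text \<open>
  The density is taken as a real function that is nonnegative everywhere, so that integrals under
  \<open>P\<close> are Bochner integrals under \<open>Q\<close> with weight \<open>f\<close>.
\<close>
locale change_of_measure = filtered_prob_space Q F
  for Q :: "'b measure" and F :: "nat \<Rightarrow> 'b measure" +
  fixes P :: "'b measure" and f :: "'b \<Rightarrow> real"
  assumes prob_space_P: "prob_space P"
    and density_measurable: "f \<in> borel_measurable Q"
    and density_nonneg: "0 \<le> f x"
    and P_density: "P = density Q (\<lambda>x. ennreal (f x))"
begin

lemma sets_P: "sets P = sets Q"
  by (simp add: P_density)

lemma space_P: "space P = space Q"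
  by (simp add: P_density)

lemma measurable_P: "h \<in> borel_measurable Q \<Longrightarrow> h \<in> borel_measurable P"
  by (simp add: P_density)

lemma AE_P: "AE x in Q. R x \<Longrightarrow> AE x in P. R x"
  unfolding P_density using density_measurable by (subst AE_density) auto

lemma integral_P:
  "h \<in> borel_measurable Q \<Longrightarrow> (\<integral>x. h x \<partial>P) = (\<integral>x. f x * h x \<partial>Q)" for h :: "'b \<Rightarrow> real"
  unfolding P_density using density_measurable density_nonneg by (subst integral_density) auto

lemma integrable_P:
  "h \<in> borel_measurable Q \<Longrightarrow> integrable P h \<longleftrightarrow> integrable Q (\<lambda>x. f x * h x)" for h :: "'b \<Rightarrow> real"
  unfolding P_density using density_measurable density_nonneg by (subst integrable_density) auto

lemma density_integrable: "integrable Q f"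
proof -
  interpret P: prob_space P by (rule prob_space_P)
  show ?thesis using integrable_P[of "\<lambda>_. 1"] by simp
qed

lemma density_integral: "(\<integral>x. f x \<partial>Q) = 1"
proof -
  interpret P: prob_space P by (rule prob_space_P)
  show ?thesis using integral_P[of "\<lambda>_. 1"] by (simp add: P.prob_space)
qed

lemma measure_P:
  assumes "A \<in> sets Q"
  shows "measure P A = (\<integral>x. indicator A x * f x \<partial>Q)"
proof -
  interpret P: prob_space P by (rule prob_space_P)
  have "measure P A = (\<integral>x. indicator A x \<partial>P)" using assms sets_P by simp
  also have "\<dots> = (\<integral>x. f x * indicator A x \<partial>Q)" by (rule integral_P) (use assms in simp)
  finally show ?thesis by (simp add: mult.commute)
qed

sublocale P: filtered_prob_space P F
proof -
  interpret P: prob_space P by (rule prob_space_P)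
  show "filtered_prob_space P F"
  proof
    show "subalgebra P (F n)" for n
      using subalgebra_F[of n] by (simp add: subalgebra_def sets_P space_P)
  qed (rule sets_F_mono)
qed

abbreviation density_at :: "nat \<Rightarrow> 'b \<Rightarrow> real" where
  "density_at n \<equiv> real_cond_exp Q (F n) f"

lemma density_at_nonneg: "AE x in Q. 0 \<le> density_at n x"
proof -
  interpret sigma_finite_subalgebra Q "F n" by (rule sigma_finite_subalgebra_F)
  show ?thesis by (intro real_cond_exp_pos density_measurable) (simp add: density_nonneg)
qed

text \<open>
  Both sides have the same integral over every \<open>A\<close> in \<open>F n\<close>: pass to \<open>P\<close>, condition there, return
  to \<open>Q\<close>, and condition the density.
\<close>
lemma Bayes_cond_exp:
  assumes h: "h \<in> borel_measurable Q" and bd: "\<And>x. \<bar>h x\<bar> \<le> c"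
  shows "AE x in Q. real_cond_exp Q (F n) (\<lambda>x. f x * h x) x = density_at n x * real_cond_exp P (F n) h x"
proof -
  interpret sigma_finite_subalgebra Q "F n" by (rule sigma_finite_subalgebra_F)
  interpret SP: sigma_finite_subalgebra P "F n" by (rule P.sigma_finite_subalgebra_F)
  have hP: "integrable P h"
    by (rule P.integrable_const_bound[of _ c, OF _ measurable_P[OF h]]) (simp add: bd)
  have fh: "integrable Q (\<lambda>x. f x * h x)" using hP integrable_P[OF h] by simp
  have eF: "real_cond_exp P (F n) h \<in> borel_measurable (F n)" by (rule borel_measurable_cond_exp)
  have eQ: "real_cond_exp P (F n) h \<in> borel_measurable Q" by (rule measurable_F[OF eF])
  \<comment> \<open>the conditional expectation under P is bounded only P-almost surely, so integrability comes from P\<close>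
  have "integrable Q (\<lambda>x. f x * real_cond_exp P (F n) h x)"
    using SP.real_cond_exp_int(1)[OF hP] integrable_P[OF eQ] by simp
  then have fe: "integrable Q (\<lambda>x. real_cond_exp P (F n) h x * f x)" by (simp add: mult.commute)
  show ?thesis
  proof (rule real_cond_exp_charact[OF _ fh])
    show "integrable Q (\<lambda>x. density_at n x * real_cond_exp P (F n) h x)"
      using real_cond_exp_intg(1)[OF fe eF density_measurable] by (simp add: mult.commute)
    show "(\<lambda>x. density_at n x * real_cond_exp P (F n) h x) \<in> borel_measurable (F n)"
      by (intro borel_measurable_times borel_measurable_cond_exp)
    fix A assume A: "A \<in> sets (F n)"
    have AQ: "A \<in> sets Q" by (rule sets_F_sub[OF A])
    have iA: "indicator A \<in> borel_measurable (F n)" using A by (rule borel_measurable_indicator)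
    have iAe: "(\<lambda>x. indicator A x * real_cond_exp P (F n) h x) \<in> borel_measurable (F n)"
      by (intro borel_measurable_times iA eF)
    have iAP: "integrable P (\<lambda>x. indicator A x * h x)"
      using integrable_mult_indicator[OF _ hP, of A] AQ sets_P by simp
    have iAfe: "integrable Q (\<lambda>x. (indicator A x * real_cond_exp P (F n) h x) * f x)"
      using integrable_mult_indicator[OF AQ fe] by (simp add: mult.assoc)
    have "(\<integral>x. indicator A x * (f x * h x) \<partial>Q) = (\<integral>x. indicator A x * h x \<partial>P)"
      using integral_P[OF borel_measurable_times[OF borel_measurable_indicator[OF AQ] h]]
      by (simp add: mult.left_commute)
    also have "\<dots> = (\<integral>x. indicator A x * real_cond_exp P (F n) h x \<partial>P)"
      by (rule SP.real_cond_exp_intg(2)[OF iAP iA measurable_P[OF h], symmetric])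
    also have "\<dots> = (\<integral>x. (indicator A x * real_cond_exp P (F n) h x) * f x \<partial>Q)"
      using integral_P[OF measurable_F[OF iAe]] by (simp add: mult.commute)
    also have "\<dots> = (\<integral>x. (indicator A x * real_cond_exp P (F n) h x) * density_at n x \<partial>Q)"
      by (rule real_cond_exp_intg(2)[OF iAfe iAe density_measurable, symmetric])
    finally show "(\<integral>x\<in>A. f x * h x \<partial>Q) = (\<integral>x\<in>A. density_at n x * real_cond_exp P (F n) h x \<partial>Q)"
      by (simp add: set_lebesgue_integral_def mult_ac)
  qed
qed

text \<open>
  Multiplying by the conditional density turns the difference into the conditional expectation of
  \<open>(f - density_at n) h\<close> under \<open>Q\<close>, whose integrand is dominated by \<open>\<bar>f - density_at n\<bar> V\<close>.
\<close>
lemma cond_exp_difference_le: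
  assumes h: "h \<in> borel_measurable Q" and V: "V \<in> borel_measurable Q"
    and hV: "\<And>x. \<bar>h x\<bar> \<le> V x" and Vb: "\<And>x. V x \<le> b"
  shows "AE x in Q. density_at n x * \<bar>real_cond_exp P (F n) h x - real_cond_exp Q (F n) h x\<bar>
    \<le> real_cond_exp Q (F n) (\<lambda>x. \<bar>f x - density_at n x\<bar> * V x) x"
proof -
  interpret sigma_finite_subalgebra Q "F n" by (rule sigma_finite_subalgebra_F)
  have hb: "\<bar>h x\<bar> \<le> b" for x using hV[of x] Vb[of x] by linarith
  have V0: "0 \<le> V x" for x using hV[of x] by linarith
  have bmul: "integrable Q (\<lambda>x. u x * v x)"
    if u: "integrable Q u" and v: "v \<in> borel_measurable Q" "\<And>x. \<bar>v x\<bar> \<le> b" for u v :: "'b \<Rightarrow> real"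
  proof (rule Bochner_Integration.integrable_bound)
    show "integrable Q (\<lambda>x. b * u x)" using u by simp
    show "(\<lambda>x. u x * v x) \<in> borel_measurable Q" using u v(1) by simp
    have "0 \<le> b" using v(2)[of undefined] by linarith
    moreover have "\<bar>u x\<bar> * \<bar>v x\<bar> \<le> \<bar>u x\<bar> * b" for x using v(2) by (intro mult_left_mono) auto
    ultimately show "AE x in Q. norm (u x * v x) \<le> norm (b * u x)"
      by (intro AE_I2) (simp add: abs_mult mult.commute)
  qed
  note f_int = density_integrable integrable_cond_exp_F[OF density_integrable, of n]
  have 1: "AE x in Q. real_cond_exp Q (F n) (\<lambda>x. f x * h x - density_at n x * h x) x
      = real_cond_exp Q (F n) (\<lambda>x. f x * h x) x - real_cond_exp Q (F n) (\<lambda>x. density_at n x * h x) x"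
    by (intro real_cond_exp_diff bmul f_int h hb)
  have 2: "AE x in Q. real_cond_exp Q (F n) (\<lambda>x. density_at n x * h x) x = density_at n x * real_cond_exp Q (F n) h x"
    by (intro real_cond_exp_mult borel_measurable_cond_exp h bmul f_int hb)
  have 3: "AE x in Q. \<bar>real_cond_exp Q (F n) (\<lambda>x. f x * h x - density_at n x * h x) x\<bar>
      \<le> real_cond_exp Q (F n) (\<lambda>x. \<bar>f x - density_at n x\<bar> * V x) x"
  proof (rule real_cond_exp_abs_le)
    show "integrable Q (\<lambda>x. f x * h x - density_at n x * h x)"
      by (intro Bochner_Integration.integrable_diff bmul f_int h hb)
    show "integrable Q (\<lambda>x. \<bar>f x - density_at n x\<bar> * V x)"
      using V0 Vb by (intro bmul integrable_abs Bochner_Integration.integrable_diff f_int V) auto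
    show "AE x in Q. \<bar>f x * h x - density_at n x * h x\<bar> \<le> \<bar>f x - density_at n x\<bar> * V x"
      using hV by (intro AE_I2) (simp add: abs_mult mult_left_mono flip: left_diff_distrib)
  qed
  show ?thesis
    using 1 2 3 Bayes_cond_exp[OF h hb, of n] density_at_nonneg[of n]
  proof eventually_elim
    case (elim x)
    have "density_at n x * \<bar>real_cond_exp P (F n) h x - real_cond_exp Q (F n) h x\<bar>
        = \<bar>density_at n x * real_cond_exp P (F n) h x - density_at n x * real_cond_exp Q (F n) h x\<bar>"
      using elim(5) by (simp add: abs_mult flip: right_diff_distrib)
    then show ?case using elim by simp
  qed
qed

text \<open>
  Absolute continuity in quantitative form: split the density at the level \<open>L\<close>.
\<close>
lemma measure_P_le_truncation:
  assumes A: "A \<in> sets Q" and L: "0 \<le> L"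
  shows "measure P A \<le> L * measure Q A + (\<integral>x. indicator {x\<in>space Q. L < f x} x * f x \<partial>Q)"
proof -
  have T: "{x\<in>space Q. L < f x} \<in> sets Q" using density_measurable by measurable
  have iA: "integrable Q (\<lambda>x. indicator A x * f x)" if "A \<in> sets Q" for A
    using integrable_mult_indicator[OF that density_integrable] by simp
  have "measure P A = (\<integral>x. indicator A x * f x \<partial>Q)" by (rule measure_P[OF A])
  also have "\<dots> \<le> (\<integral>x. indicator A x * L + indicator {x\<in>space Q. L < f x} x * f x \<partial>Q)"
  proof (rule integral_mono)
    show "integrable Q (\<lambda>x. indicator A x * L + indicator {x\<in>space Q. L < f x} x * f x)"
      using A by (intro Bochner_Integration.integrable_add iA T integrable_mult_left integrable_real_indicator)
        (auto simp: less_top[symmetric])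
    show "indicator A x * f x \<le> indicator A x * L + indicator {x\<in>space Q. L < f x} x * f x" if "x \<in> space Q" for x
      using L that density_nonneg[of x] by (auto split: split_indicator)
  qed (rule iA[OF A])
  also have "\<dots> = L * measure Q A + (\<integral>x. indicator {x\<in>space Q. L < f x} x * f x \<partial>Q)"
    using A iA[OF T] by (subst Bochner_Integration.integral_add)
      (auto intro!: integrable_mult_left integrable_real_indicator simp: less_top[symmetric] mult.commute)
  finally show ?thesis .
qed

lemma density_tail_tendsto_0: "(\<lambda>k. \<integral>x. indicator {x\<in>space Q. real k < f x} x * f x \<partial>Q) \<longlonglongrightarrow> 0"
proof -
  have "(\<lambda>k. \<integral>x. indicator {x\<in>space Q. real k < f x} x * f x \<partial>Q) \<longlonglongrightarrow> (\<integral>x. 0 \<partial>Q)"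
  proof (rule integral_dominated_convergence[OF _ _ density_integrable])
    show "AE x in Q. (\<lambda>k. indicator {x\<in>space Q. real k < f x} x * f x) \<longlonglongrightarrow> 0"
    proof (rule AE_I2)
      fix x
      obtain k0 where "f x < real k0" using reals_Archimedean2 by blast
      then have "indicator {x\<in>space Q. real k < f x} x * f x = 0" if "k0 \<le> k" for k
        using that by (auto split: split_indicator)
      then have "\<forall>\<^sub>F k in sequentially. indicator {x\<in>space Q. real k < f x} x * f x = 0"
        unfolding eventually_sequentially by blast
      then show "(\<lambda>k. indicator {x\<in>space Q. real k < f x} x * f x) \<longlonglongrightarrow> 0" by (rule tendsto_eventually)
    qed
    show "AE x in Q. norm (indicator {x\<in>space Q. real k < f x} x * f x) \<le> f x" for k
      using density_nonneg by (intro AE_I2) (auto split: split_indicator)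
    show "(\<lambda>x. indicator {x\<in>space Q. real k < f x} x * f x) \<in> borel_measurable Q" for k
      using density_measurable by measurable
  qed simp
  then show ?thesis by simp
qed

text \<open>
  Markov's inequality gives \<open>Q(density_at n > K) \<le> 1/K\<close> uniformly in \<open>n\<close>, as every conditional density
  has mean 1; absolute continuity carries this over to \<open>P\<close>.
\<close>
lemma density_at_tight:
  assumes "0 < \<delta>"
  shows "\<exists>K>0. \<forall>n. measure P {x\<in>space Q. K < density_at n x} < \<delta>"
proof -
  obtain k where k: "(\<integral>x. indicator {x\<in>space Q. real k < f x} x * f x \<partial>Q) < \<delta> / 2"
    using order_tendstoD(2)[OF density_tail_tendsto_0, of "\<delta> / 2"] assms by (auto simp: eventually_sequentially)
  \<comment> \<open>chosen so that k / K is at most half of the allowance; the summand 1 keeps K positive when k = 0\<close>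
  define K where "K = 2 * real k / \<delta> + 1"
  have K: "0 < K" using assms by (simp add: K_def add_nonneg_pos)
  have "measure P {x\<in>space Q. K < density_at n x} < \<delta>" for n
  proof -
    interpret sigma_finite_subalgebra Q "F n" by (rule sigma_finite_subalgebra_F)
    let ?A = "{x\<in>space Q. K < density_at n x}"
    have dm: "density_at n \<in> borel_measurable Q" by (rule borel_measurable_cond_exp2)
    have A: "?A \<in> sets Q" using dm by measurable
    have "measure Q ?A \<le> measure Q {x\<in>space Q. K \<le> density_at n x}"
      using dm by (intro finite_measure_mono) auto
    also have "\<dots> \<le> (\<integral>x. density_at n x \<partial>Q) / K"
      using integral_Markov_inequality_measure[OF integrable_cond_exp_F[OF density_integrable] sets.empty_sets _ K, of n]
        density_at_nonneg[of n] by simp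
    also have "\<dots> = 1 / K"
      using real_cond_exp_int(2)[OF density_integrable] by (simp add: density_integral)
    finally have "real k * measure Q ?A \<le> real k * (1 / K)" by (rule mult_left_mono) simp
    also have "\<dots> \<le> \<delta> / 2"
      using assms K by (simp add: K_def field_simps)
    finally show ?thesis using measure_P_le_truncation[OF A, of "real k"] k by simp
  qed
  then show ?thesis using K by blast
qed

text \<open>
  On the event \<open>E\<close> where the supremum exceeds \<open>\<epsilon>\<close> and the conditional density is at most \<open>K\<close>, the
  previous estimate gives \<open>\<epsilon> P(E) \<le> E\<^sub>Q(1\<^sub>E \<bar>f - density_at n\<bar> V)\<close>. Where \<open>V \<le> c\<close> the integrand is at most
  \<open>c \<bar>f - density_at n\<bar>\<close>; elsewhere \<open>\<bar>f - density_at n\<bar> \<le> f + K\<close> yields the tails of \<open>V\<close> under \<open>P\<close> and \<open>Q\<close>.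
  Truncating the conditional density is what makes uniform integrability under \<open>Q\<close> sufficient.
\<close>
lemma sup_cond_exp_difference_prob_le:
  fixes h :: "'d \<Rightarrow> 'b \<Rightarrow> real"
  assumes D: "countable D" and h: "\<And>B. B \<in> D \<Longrightarrow> h B \<in> borel_measurable Q"
    and V: "V \<in> borel_measurable Q" and hV: "\<And>B x. B \<in> D \<Longrightarrow> \<bar>h B x\<bar> \<le> V x"
    and Vb: "\<And>x. 0 \<le> V x" "\<And>x. V x \<le> b" and "0 < K" "0 \<le> c" "0 < \<epsilon>"
  shows "\<epsilon> * measure P {x\<in>space Q. \<epsilon> < sup_norm D (\<lambda>B. real_cond_exp P (F n) (h B) x - real_cond_exp Q (F n) (h B) x)}
    \<le> \<epsilon> * measure P {x\<in>space Q. K < density_at n x} + c * (\<integral>x. \<bar>f x - density_at n x\<bar> \<partial>Q)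
      + (\<integral>x. indicator {x\<in>space Q. c < V x} x * V x \<partial>P) + K * (\<integral>x. indicator {x\<in>space Q. c < V x} x * V x \<partial>Q)"
proof -
  interpret sigma_finite_subalgebra Q "F n" by (rule sigma_finite_subalgebra_F)
  define \<Delta> where "\<Delta> x = sup_norm D (\<lambda>B. real_cond_exp P (F n) (h B) x - real_cond_exp Q (F n) (h B) x)" for x
  define G where "G x = \<bar>f x - density_at n x\<bar> * V x" for x
  define E where "E = {x\<in>space Q. \<epsilon> < \<Delta> x \<and> density_at n x \<le> K}"
  define T where "T = {x\<in>space Q. c < V x}"
  note f_int = density_integrable integrable_cond_exp_F[OF density_integrable, of n]
  have \<Delta>F: "\<Delta> \<in> borel_measurable (F n)"
    unfolding \<Delta>_def[abs_def]
    by (intro countable_sup_norm_measurable D borel_measurable_diff borel_measurable_cond_exp)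
  have dF: "density_at n \<in> borel_measurable (F n)" by (rule borel_measurable_cond_exp)
  note \<Delta>Q = measurable_F[OF \<Delta>F] and dQ = measurable_F[OF dF]
  have EF: "E \<in> sets (F n)"
    unfolding E_def space_F[of n, symmetric] using \<Delta>F dF by measurable
  note EQ = sets_F_sub[OF EF]
  have iE: "indicator E \<in> borel_measurable (F n)" using EF by (rule borel_measurable_indicator)
  have TQ: "T \<in> sets Q" unfolding T_def using V by measurable
  have V_int: "integrable Q V"
    by (rule integrable_const_bound[of _ b, OF _ V]) (use Vb in simp)
  have V_intP: "integrable P V"
    by (rule P.integrable_const_bound[of _ b, OF _ measurable_P[OF V]]) (use Vb in simp)
  have fV_int: "integrable Q (\<lambda>x. f x * V x)" using V_intP integrable_P[OF V] by simp
  have G_int: "integrable Q G"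
    unfolding G_def[abs_def]
  proof (rule Bochner_Integration.integrable_bound)
    show "integrable Q (\<lambda>x. b * \<bar>f x - density_at n x\<bar>)"
      by (intro integrable_mult_right integrable_abs Bochner_Integration.integrable_diff f_int)
    show "(\<lambda>x. \<bar>f x - density_at n x\<bar> * V x) \<in> borel_measurable Q"
      by (intro borel_measurable_times borel_measurable_abs borel_measurable_diff density_measurable dQ V)
    show "AE x in Q. norm (\<bar>f x - density_at n x\<bar> * V x) \<le> norm (b * \<bar>f x - density_at n x\<bar>)"
    proof (rule AE_I2)
      fix x
      have "\<bar>f x - density_at n x\<bar> * \<bar>V x\<bar> \<le> \<bar>f x - density_at n x\<bar> * \<bar>b\<bar>"
        using Vb[of x] by (intro mult_left_mono) auto
      then show "norm (\<bar>f x - density_at n x\<bar> * V x) \<le> norm (b * \<bar>f x - density_at n x\<bar>)"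
        by (simp add: abs_mult mult.commute)
    qed
  qed
  have sup: "AE x in Q. density_at n x * \<Delta> x \<le> real_cond_exp Q (F n) G x"
  proof -
    have "AE x in Q. \<forall>B\<in>D. density_at n x * \<bar>real_cond_exp P (F n) (h B) x - real_cond_exp Q (F n) (h B) x\<bar> \<le> real_cond_exp Q (F n) G x"
      unfolding G_def[abs_def] AE_ball_countable[OF D]
      by (intro ballI cond_exp_difference_le[where b=b] h V hV Vb)
    moreover have "AE x in Q. 0 \<le> real_cond_exp Q (F n) G x"
      using Vb(1) by (intro real_cond_exp_pos borel_measurable_integrable[OF G_int]) (simp add: G_def)
    ultimately show ?thesis
      using density_at_nonneg[of n]
    proof eventually_elim
      case (elim x)
      show ?case
        unfolding \<Delta>_def sup_norm_cmult[OF elim(3), symmetric]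
        by (rule sup_norm_le) (use elim in \<open>auto simp: abs_mult\<close>)
    qed
  qed
  have iEi: "integrable Q (\<lambda>x. indicator E x * u x)" if "integrable Q u" for u :: "'b \<Rightarrow> real"
    using integrable_mult_indicator[OF EQ that] by simp
  have iTi: "integrable Q (\<lambda>x. indicator T x * u x)" if "integrable Q u" for u :: "'b \<Rightarrow> real"
    using integrable_mult_indicator[OF TQ that] by simp
  have "\<epsilon> * measure P E = \<epsilon> * (\<integral>x. indicator E x * density_at n x \<partial>Q)"
    using measure_P[OF EQ] real_cond_exp_intg(2)[OF iEi[OF density_integrable] iE density_measurable] by simp
  also have "\<dots> = (\<integral>x. \<epsilon> * (indicator E x * density_at n x) \<partial>Q)" by simp
  also have "\<dots> \<le> (\<integral>x. indicator E x * real_cond_exp Q (F n) G x \<partial>Q)"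
  proof (rule integral_mono_AE)
    show "integrable Q (\<lambda>x. \<epsilon> * (indicator E x * density_at n x))"
      by (intro integrable_mult_right iEi f_int)
    show "integrable Q (\<lambda>x. indicator E x * real_cond_exp Q (F n) G x)"
      by (intro iEi integrable_cond_exp_F G_int)
    show "AE x in Q. \<epsilon> * (indicator E x * density_at n x) \<le> indicator E x * real_cond_exp Q (F n) G x"
      using sup density_at_nonneg[of n]
    proof eventually_elim
      case (elim x)
      show ?case
      proof (cases "x \<in> E")
        case True
        then have "\<epsilon> * density_at n x \<le> density_at n x * \<Delta> x"
          using elim(2) mult_right_mono[of \<epsilon> "\<Delta> x" "density_at n x"] by (simp add: E_def mult.commute)
        then show ?thesis using True elim(1) by simp
      qed simp
    qed
  qed
  also have "\<dots> = (\<integral>x. indicator E x * G x \<partial>Q)"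
    by (rule real_cond_exp_intg(2)[OF iEi[OF G_int] iE borel_measurable_integrable[OF G_int]])
  also have "\<dots> \<le> (\<integral>x. c * \<bar>f x - density_at n x\<bar> + indicator T x * (f x * V x) + K * (indicator T x * V x) \<partial>Q)"
  proof (rule integral_mono_AE)
    show "integrable Q (\<lambda>x. c * \<bar>f x - density_at n x\<bar> + indicator T x * (f x * V x) + K * (indicator T x * V x))"
      by (intro Bochner_Integration.integrable_add integrable_mult_right integrable_abs
          Bochner_Integration.integrable_diff f_int iTi fV_int V_int)
    show "AE x in Q. indicator E x * G x \<le> c * \<bar>f x - density_at n x\<bar> + indicator T x * (f x * V x) + K * (indicator T x * V x)"
      using density_at_nonneg[of n] AE_space
    proof eventually_elim
      case (elim x)
      have rhs: "0 \<le> c * \<bar>f x - density_at n x\<bar> + indicator T x * (f x * V x) + K * (indicator T x * V x)"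
        using \<open>0 \<le> c\<close> \<open>0 < K\<close> Vb(1)[of x] density_nonneg[of x] by simp
      show ?case
      proof (cases "x \<in> E")
        case xE: True
        show ?thesis
        proof (cases "x \<in> T")
          case True
          have "\<bar>f x - density_at n x\<bar> \<le> f x + K"
            using xE elim(1) density_nonneg[of x] by (auto simp: E_def)
          then have "G x \<le> (f x + K) * V x"
            unfolding G_def by (rule mult_right_mono[OF _ Vb(1)])
          moreover have "0 \<le> c * \<bar>f x - density_at n x\<bar>" using \<open>0 \<le> c\<close> by simp
          ultimately show ?thesis using True xE by (simp add: distrib_right)
        next
          case False
          then have "V x \<le> c" using elim(2) by (simp add: T_def)
          then have "G x \<le> \<bar>f x - density_at n x\<bar> * c"
            unfolding G_def by (intro mult_left_mono) auto
          then show ?thesis using False xE by (simp add: mult.commute)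
        qed
      qed (use rhs in simp)
    qed
  qed (rule iEi[OF G_int])
  also have "\<dots> = c * (\<integral>x. \<bar>f x - density_at n x\<bar> \<partial>Q) + (\<integral>x. indicator T x * (f x * V x) \<partial>Q) + K * (\<integral>x. indicator T x * V x \<partial>Q)"
    using f_int iTi[OF fV_int] iTi[OF V_int] by simp
  also have "(\<integral>x. indicator T x * (f x * V x) \<partial>Q) = (\<integral>x. indicator T x * V x \<partial>P)"
    using integral_P[OF borel_measurable_times[OF borel_measurable_indicator[OF TQ] V]] by (simp add: mult.left_commute)
  finally have main: "\<epsilon> * measure P E \<le> c * (\<integral>x. \<bar>f x - density_at n x\<bar> \<partial>Q)
      + (\<integral>x. indicator T x * V x \<partial>P) + K * (\<integral>x. indicator T x * V x \<partial>Q)" .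
  let ?A = "{x\<in>space Q. K < density_at n x}"
  have AQ: "?A \<in> sets P" unfolding sets_P using dQ by measurable
  have "measure P {x\<in>space Q. \<epsilon> < \<Delta> x} \<le> measure P (?A \<union> E)"
    using AQ EQ by (intro P.finite_measure_mono) (auto simp: E_def sets_P)
  also have "\<dots> \<le> measure P ?A + measure P E"
    using AQ EQ by (intro measure_Un_le) (auto simp: sets_P)
  finally have "\<epsilon> * measure P {x\<in>space Q. \<epsilon> < \<Delta> x} \<le> \<epsilon> * measure P ?A + \<epsilon> * measure P E"
    using \<open>0 < \<epsilon>\<close> by (simp flip: distrib_left)
  then show ?thesis using main unfolding \<Delta>_def T_def by linarith
qed

text \<open>
  The constants are chosen in the order \<open>K\<close>, \<open>c\<close>, \<open>n\<close>: the tail of \<open>V\<close> under \<open>Q\<close> has to beat \<open>K\<close>, and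
  the \<open>L\<^sup>1\<close> convergence of the conditional densities has to beat \<open>c\<close>.
\<close>
theorem sup_cond_exp_difference_tendsto_0:
  fixes h :: "nat \<Rightarrow> 'd \<Rightarrow> 'b \<Rightarrow> real"
  assumes gen: "sets Q = sigma_sets (space Q) (\<Union>n. sets (F n))"
    and D: "countable D" and h: "\<And>n B. B \<in> D \<Longrightarrow> h n B \<in> borel_measurable Q"
    and V: "\<And>n. V n \<in> borel_measurable Q" and hV: "\<And>n B x. B \<in> D \<Longrightarrow> \<bar>h n B x\<bar> \<le> V n x"
    and Vb: "\<And>n x. 0 \<le> V n x" "\<And>n x. V n x \<le> b n"
    and ui: "uniformly_integrable Q V" "uniformly_integrable P V" and \<epsilon>: "0 < \<epsilon>"
  shows "(\<lambda>n. measure P {x\<in>space Q. \<epsilon> <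
      sup_norm D (\<lambda>B. real_cond_exp P (F n) (h n B) x - real_cond_exp Q (F n) (h n B) x)}) \<longlonglongrightarrow> 0"
proof (rule LIMSEQ_I)
  fix \<delta> :: real assume \<delta>: "0 < \<delta>"
  \<comment> \<open>each of the four terms of the estimate gets a quarter\<close>
  define \<eta> where "\<eta> = \<delta> / 4"
  have \<eta>: "0 < \<eta>" using \<delta> by (simp add: \<eta>_def)
  have V_int: "integrable Q (V n)" "integrable P (V n)" for n
    by (rule integrable_const_bound[of _ "b n", OF _ V], use Vb in simp)
       (rule P.integrable_const_bound[of _ "b n", OF _ measurable_P[OF V]], use Vb in simp)
  obtain K where K: "0 < K" "\<And>n. measure P {x\<in>space Q. K < density_at n x} < \<eta>"
    using density_at_tight[OF \<eta>] by blast
  obtain c1 where c1: "\<And>c n. c1 \<le> c \<Longrightarrow> 1 \<le> n \<Longrightarrow> (\<integral>x. indicator {x\<in>space P. c < V n x} x * V n x \<partial>P) \<le> \<epsilon> * \<eta>"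
    using uniformly_integrable_tail[OF ui(2) V_int(2) Vb(1), of "\<epsilon> * \<eta>"] \<epsilon> \<eta> by auto
  obtain c2 where c2: "\<And>c n. c2 \<le> c \<Longrightarrow> 1 \<le> n \<Longrightarrow> (\<integral>x. indicator {x\<in>space Q. c < V n x} x * V n x \<partial>Q) \<le> \<epsilon> * \<eta> / K"
    using uniformly_integrable_tail[OF ui(1) V_int(1) Vb(1), of "\<epsilon> * \<eta> / K"] \<epsilon> \<eta> K by auto
  define c where "c = max 1 (max c1 c2)"
  have c: "0 < c" "c1 \<le> c" "c2 \<le> c" by (auto simp: c_def)
  obtain n0 where n0: "\<And>n. n \<ge> n0 \<Longrightarrow> (\<integral>x. \<bar>f x - density_at n x\<bar> \<partial>Q) < \<epsilon> * \<eta> / c"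
    using order_tendstoD(2)[OF Levy_upward_L1[OF gen density_integrable], of "\<epsilon> * \<eta> / c"] \<epsilon> \<eta> c(1)
    by (auto simp: eventually_sequentially)
  let ?E = "\<lambda>n. {x\<in>space Q. \<epsilon> < sup_norm D (\<lambda>B. real_cond_exp P (F n) (h n B) x - real_cond_exp Q (F n) (h n B) x)}"
  have "measure P (?E n) < \<delta>" if n: "n \<ge> max 1 n0" for n
  proof -
    have "\<epsilon> * measure P (?E n) \<le> \<epsilon> * measure P {x\<in>space Q. K < density_at n x} + c * (\<integral>x. \<bar>f x - density_at n x\<bar> \<partial>Q)
      + (\<integral>x. indicator {x\<in>space Q. c < V n x} x * V n x \<partial>P) + K * (\<integral>x. indicator {x\<in>space Q. c < V n x} x * V n x \<partial>Q)"
      by (rule sup_cond_exp_difference_prob_le[OF D h V hV Vb K(1) less_imp_le[OF c(1)] \<epsilon>])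
    also have "\<epsilon> * measure P {x\<in>space Q. K < density_at n x} < \<epsilon> * \<eta>"
      using K(2) \<epsilon> by simp
    also have "c * (\<integral>x. \<bar>f x - density_at n x\<bar> \<partial>Q) \<le> \<epsilon> * \<eta>"
      using n0[of n] n c(1) by (simp add: pos_less_divide_eq mult.commute)
    also have "(\<integral>x. indicator {x\<in>space Q. c < V n x} x * V n x \<partial>P) \<le> \<epsilon> * \<eta>"
      using c1[OF c(2), of n] n by (simp add: space_P)
    also have "K * (\<integral>x. indicator {x\<in>space Q. c < V n x} x * V n x \<partial>Q) \<le> \<epsilon> * \<eta>"
      using c2[OF c(3), of n] n K(1) by (simp add: pos_le_divide_eq mult.commute)
    finally have "\<epsilon> * measure P (?E n) < \<epsilon> * \<delta>" by (simp add: \<eta>_def mult.commute)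
    then show ?thesis by (simp only: mult_less_cancel_left_pos[OF \<epsilon>])
  qed
  then show "\<exists>n0. \<forall>n\<ge>n0. norm (measure P (?E n) - 0) < \<delta>"
    by (intro exI[of _ "max 1 n0"]) auto
qed

end

section \<open>Stable convergence of the norm of the predictive deviations\<close>
theorem theorem1:
  fixes S :: "'a measure"
    and P Q :: "(nat \<Rightarrow> 'a) measure"
    and D D0 :: "'a set set"
    and N :: "(nat \<Rightarrow> 'a) \<Rightarrow> real measure"
  assumes P: "prob_space P" "sets P = sets (seq_space S)"
    and Q: "prob_space Q" "sets Q = sets (seq_space S)"
    and cid: "cid S P"
    and D: "D \<subseteq> sets S" "countably_determines S D0 D"
    and N: "N \<in> seq_space S \<rightarrow>\<^sub>M prob_algebra borel"
    and stable_Q: "stably_converges Q (\<lambda>n \<omega>. sup_norm D0 (\<lambda>B. C S Q n B \<omega>)) N"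
    and ui_P: "uniformly_integrable P (\<lambda>n \<omega>. sup_norm D0 (\<lambda>B. W n B \<omega>))"
    and ui_Q: "uniformly_integrable Q (\<lambda>n \<omega>. sup_norm D0 (\<lambda>B. W n B \<omega>))"
    and ac: "absolutely_continuous Q P"
  shows "(\<forall>n\<ge>1. AE \<omega> in P.
            sup_norm D0 (\<lambda>B. C S P n B \<omega>) =
              sqrt (real n) * sup_norm D0 (\<lambda>B. emp n B \<omega> - pred S P n B \<omega>))
       \<and> stably_converges P (\<lambda>n \<omega>. sup_norm D0 (\<lambda>B. C S P n B \<omega>)) N
       \<and> stably_converges P
           (\<lambda>n \<omega>. sqrt (real n) * sup_norm D0 (\<lambda>B. emp n B \<omega> - pred S P n B \<omega>)) N"
proof -
  have D0: "countable D0" "\<And>B. B \<in> D0 \<Longrightarrow> B \<in> sets S"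
    using D by (auto simp: countably_determines_def)
  interpret P0: prob_space P by fact
  interpret Q0: prob_space Q by fact
  obtain f where f: "f \<in> borel_measurable Q" "AE x in Q. RN_deriv Q P x = ennreal (f x)" "\<And>x. 0 \<le> f x"
    using Q0.real_RN_deriv[OF P0.finite_measure_axioms ac] P(2) Q(2) by metis
  have "density Q (\<lambda>x. ennreal (f x)) = density Q (RN_deriv Q P)"
    using f by (intro density_cong) auto
  then have Pf: "P = density Q (\<lambda>x. ennreal (f x))"
    using Q0.density_RN_deriv[OF ac] P(2) Q(2) by simp
  interpret filtered_prob_space Q "hist S" by (rule filtered_prob_space_hist[OF Q])
  interpret change_of_measure Q "hist S" P f
    by unfold_locales (rule P(1) f(1) f(3) Pf)+
  have gen: "sets Q = sigma_sets (space Q) (\<Union>n. sets (hist S n))"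
    using sets_seq_space_generated[of S] Q(2) sets_eq_imp_space_eq[OF Q(2)] by simp
  define V where "V n \<omega> = sup_norm D0 (\<lambda>B. W n B \<omega>)" for n \<omega>
  define \<Delta> where "\<Delta> n \<omega> = sup_norm D0 (\<lambda>B. C S P n B \<omega> - C S Q n B \<omega>)" for n \<omega>
  define ZQ where "ZQ n \<omega> = sup_norm D0 (\<lambda>B. C S Q n B \<omega>)" for n \<omega>
  define ZP where "ZP n \<omega> = sup_norm D0 (\<lambda>B. C S P n B \<omega>)" for n \<omega>
  define ZE where "ZE n \<omega> = sqrt (real n) * sup_norm D0 (\<lambda>B. emp n B \<omega> - pred S P n B \<omega>)" for n \<omega>
  have W: "W n B \<in> borel_measurable Q" if "B \<in> D0" for n B
    by (rule measurable_seq_space[OF Q(2) W_measurable[OF D0(2)[OF that]]])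
  have CQ: "C S R n B \<in> borel_measurable Q" for R n B by (rule measurable_F[OF C_hist_measurable])
  have V: "V n \<in> borel_measurable Q" for n
    unfolding V_def[abs_def] by (intro countable_sup_norm_measurable D0(1) W)
  have ZQ: "ZQ n \<in> borel_measurable Q" for n
    unfolding ZQ_def[abs_def] by (intro countable_sup_norm_measurable D0(1) CQ)
  have ZP: "ZP n \<in> borel_measurable Q" for n
    unfolding ZP_def[abs_def] by (intro countable_sup_norm_measurable D0(1) CQ)
  have \<Delta>: "\<Delta> n \<in> borel_measurable Q" for n
    unfolding \<Delta>_def[abs_def] by (intro countable_sup_norm_measurable D0(1) borel_measurable_diff CQ)
  have ZE: "ZE n \<in> borel_measurable Q" for n
    unfolding ZE_def[abs_def]
    by (intro borel_measurable_times borel_measurable_const countable_sup_norm_measurable D0(1)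
        borel_measurable_diff measurable_F[OF emp_hist_measurable] D0(2) measurable_F[OF pred_adapted[OF P cid D0(2)]])
  have eq: "AE \<omega> in P. ZP n \<omega> = ZE n \<omega>" for n
  proof -
    have "AE \<omega> in P. \<forall>B\<in>D0. C S P n B \<omega> = sqrt (real n) * (emp n B \<omega> - pred S P n B \<omega>)"
      unfolding AE_ball_countable[OF D0(1)] by (intro ballI C_eq_emp_minus_pred P cid D0(2))
    then show ?thesis
    proof eventually_elim
      case (elim \<omega>)
      then have "ZP n \<omega> = sup_norm D0 (\<lambda>B. sqrt (real n) * (emp n B \<omega> - pred S P n B \<omega>))"
        unfolding ZP_def sup_norm_def by (intro arg_cong[where f=enn2real] SUP_cong) auto
      then show ?case by (simp add: ZE_def sup_norm_cmult)
    qed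
  qed
  have diff: "AE \<omega> in P. \<bar>ZP n \<omega> - ZQ n \<omega>\<bar> \<le> \<Delta> n \<omega>" for n
  proof -
    have "AE \<omega> in P. \<forall>B\<in>D0. \<bar>C S P n B \<omega>\<bar> \<le> sqrt (real n)"
      unfolding AE_ball_countable[OF D0(1)] by (intro ballI C_bound P D0(2))
    moreover have "AE \<omega> in P. \<forall>B\<in>D0. \<bar>C S Q n B \<omega>\<bar> \<le> sqrt (real n)"
      unfolding AE_ball_countable[OF D0(1)] by (intro ballI AE_P C_bound Q D0(2))
    ultimately show ?thesis
      unfolding ZP_def ZQ_def \<Delta>_def by eventually_elim (rule sup_norm_diff_le, auto)
  qed
  have \<Delta>_lim: "(\<lambda>n. measure P {\<omega>\<in>space Q. \<epsilon> < \<Delta> n \<omega>}) \<longlonglongrightarrow> 0" if "0 < \<epsilon>" for \<epsilon>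
    unfolding \<Delta>_def C_def
  proof (rule sup_cond_exp_difference_tendsto_0[OF gen D0(1) W V _ _ _ _ _ that, where b="\<lambda>n. sqrt (real n)"])
    show "\<bar>W n B \<omega>\<bar> \<le> V n \<omega>" if "B \<in> D0" for n B \<omega>
      unfolding V_def by (rule abs_le_sup_norm[OF W_bound that])
    show "0 \<le> V n \<omega>" "V n \<omega> \<le> sqrt (real n)" for n \<omega>
      unfolding V_def by (simp_all add: sup_norm_nonneg sup_norm_le W_bound)
    show "uniformly_integrable Q V" "uniformly_integrable P V"
      using ui_P ui_Q by (simp_all add: V_def[abs_def])
  qed
  \<comment> \<open>the norm of C and its expression through pred agree almost surely, so both are instances\<close>
  have stable: "stably_converges P Z N"
    if Z: "\<And>n. Z n \<in> borel_measurable Q" and ZP_Z: "\<And>n. AE \<omega> in P. ZP n \<omega> = Z n \<omega>" for Z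
  proof (rule stably_converges_change_of_measure[OF Q(1) P(1) f(1,3) Pf])
    show "N \<in> Q \<rightarrow>\<^sub>M prob_algebra borel" using N measurable_cong_sets[OF Q(2) refl] by blast
    show "stably_converges Q ZQ N" using stable_Q by (simp add: ZQ_def[abs_def])
    show "ZQ n \<in> borel_measurable Q" "Z n \<in> borel_measurable Q" for n by (rule ZQ, rule Z)
    fix \<epsilon> :: real assume \<epsilon>: "0 < \<epsilon>"
    have "measure P {\<omega>\<in>space P. \<epsilon> < \<bar>Z n \<omega> - ZQ n \<omega>\<bar>} \<le> measure P {\<omega>\<in>space Q. \<epsilon> < \<Delta> n \<omega>}" for n
    proof (rule P0.finite_measure_mono_AE)
      show "{\<omega>\<in>space Q. \<epsilon> < \<Delta> n \<omega>} \<in> sets P" unfolding sets_P using \<Delta>[of n] by measurable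
      show "AE \<omega> in P. \<omega> \<in> {\<omega>\<in>space P. \<epsilon> < \<bar>Z n \<omega> - ZQ n \<omega>\<bar>} \<longrightarrow> \<omega> \<in> {\<omega>\<in>space Q. \<epsilon> < \<Delta> n \<omega>}"
        using diff[of n] ZP_Z[of n] by eventually_elim (auto simp: space_P)
    qed
    then show "(\<lambda>n. measure P {\<omega>\<in>space P. \<epsilon> < \<bar>Z n \<omega> - ZQ n \<omega>\<bar>}) \<longlonglongrightarrow> 0"
      by (intro tendsto_sandwich[OF _ _ tendsto_const \<Delta>_lim[OF \<epsilon>]]) auto
  qed
  have "\<forall>n\<ge>1. AE \<omega> in P. ZP n \<omega> = ZE n \<omega>" using eq by simp
  moreover have "stably_converges P ZP N" by (rule stable[OF ZP]) simp
  moreover have "stably_converges P ZE N" by (rule stable[OF ZE eq])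
  ultimately show ?thesis
    by (simp add: ZP_def[abs_def] ZE_def[abs_def])
qed

end
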